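(* Let $P$ be the transition kernel of the solution $X_t$ of the SDE $\mathrm{d}X_t = f(X_t)\,\mathrm{d}t + \sigma(X_t)\,\mathrm{d}W_t$ in $\mathbb{R}^n$. Let $\hat P$ be the transition kernel of a numerical scheme $\hat X_t$ for this SDE with time step $h>0$, where $\hat X_t$ is a time-homogeneous Markov chain on $\mathbb{R}^n$ with times $t = 0, h, 2h, \dots$. Let $\pi$ and $\hat\pi$ be the invariant probability measures of $X_t$ and $\hat X_t$ respectively. Let $T>0$ be a fixed multiple of $h$. Suppose there are a compact set $\Omega\subset\mathbb{R}^n$ and a constant $0<\epsilon<1$ such that $$\pi(\Omega^c)<\epsilon,\qquad \hat\pi(\Omega^c)<\epsilon,\qquad (\pi\hat P^T)(\Omega^c)<\epsilon .$$ Set $$\alpha_\Omega=\sup_{(x,y)\in\Omega\times\Omega,\ x\neq y}\frac{\mathrm{d}_w(\delta_x\hat P^T,\delta_y\hat P^T)}{d(x,y)},$$ and suppose $\alpha_\Omega<1$. Then $$\mathrm{d}_w(\pi,\hat\pi)\le\frac{\mathrm{d}_w(\pi P^T,\pi\hat P^T)+2\epsilon}{1-\alpha_\Omega}.$$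
   Context: The metric on $\mathbb{R}^n$ is $d(x,y)=\min\{1,\|x-y\|\}$. For Borel probability measures $\mu,\nu$ on $\mathbb{R}^n$, $$\mathrm{d}_w(\mu,\nu)=\inf\Big\{\int_{\mathbb{R}^n\times\mathbb{R}^n} d(x,y)\,\gamma(\mathrm{d}x,\mathrm{d}y) : \gamma \text{ is a coupling of } \mu \text{ and } \nu\Big\},$$ where a coupling of $\mu$ and $\nu$ is a probability measure on $\mathbb{R}^n\times\mathbb{R}^n$ with marginals $\mu$ and $\nu$. In the SDE, $f$ is a continuous vector field on $\mathbb{R}^n$, $\sigma$ is an $n\times m$ matrix-valued function, and $W_t$ is a Wiener process in $\mathbb{R}^m$. Standing assumptions: the SDE has a unique solution defining a Markov process $X_t$ with a unique invariant probability measure $\pi$, and the scheme has an invariant probability measure $\hat\pi$. $P^T$ and $\hat P^T$ denote the time-$T$ transition kernels of $X_t$ and $\hat X_t$ (for the scheme, $T$ is the physical time, so $\hat P^T$ is the kernel of $T/h$ steps of the scheme). For a probability measure $\mu$, $\mu P^T(A)=\int P^T(x,A)\,\mu(\mathrm{d}x)$, and similarly for $\mu\hat P^T$. Invariance means $\pi P^T=\pi$ and $\hat\pi\hat P^T=\hat\pi$. $\delta_x$ is the Dirac mass at $x$, and $\Omega^c$ is the complement of $\Omega$ in $\mathbb{R}^n$. *)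

theory Defs
  imports "HOL-Probability.Probability"
begin

section \<open>The truncated metric and the associated Wasserstein distance\<close>

definition tdist :: "'a::real_normed_vector \<Rightarrow> 'a \<Rightarrow> real" where
  "tdist x y = min 1 (norm (x - y))"

definition coupling :: "'a::euclidean_space measure \<Rightarrow> 'a measure \<Rightarrow> ('a \<times> 'a) measure \<Rightarrow> bool" where
  "coupling \<mu> \<nu> \<gamma> \<longleftrightarrow>
     sets \<gamma> = sets borel \<and> prob_space \<gamma> \<and> distr \<gamma> borel fst = \<mu> \<and> distr \<gamma> borel snd = \<nu>"

text \<open>For Borel probability measures the infimum is over a nonempty set of reals bounded below
  by 0, so the real-valued infimum is the intended one.\<close>
definition d_w :: "'a::euclidean_space measure \<Rightarrow> 'a measure \<Rightarrow> real" where
  "d_w \<mu> \<nu> = (INF \<gamma> \<in> Collect (coupling \<mu> \<nu>). \<integral>z. tdist (fst z) (snd z) \<partial>\<gamma>)"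

section \<open>Transition kernels\<close>

definition markov_kernel :: "('a::euclidean_space \<Rightarrow> 'a measure) \<Rightarrow> bool" where
  "markov_kernel K \<longleftrightarrow> K \<in> borel \<rightarrow>\<^sub>M prob_algebra borel"

text \<open>The measure \<open>\<mu> K\<close>, that is \<open>A \<mapsto> \<integral> K(x, A) \<mu>(dx)\<close>, is the Giry bind \<open>\<mu> \<bind> K\<close>.\<close>

fun kernel_power :: "('a::euclidean_space \<Rightarrow> 'a measure) \<Rightarrow> nat \<Rightarrow> 'a \<Rightarrow> 'a measure" where
  "kernel_power K 0 = return borel"
| "kernel_power K (Suc k) = (\<lambda>x. kernel_power K k x \<bind> K)"

definition invariant_prob ::
    "real set \<Rightarrow> (real \<Rightarrow> 'a::euclidean_space \<Rightarrow> 'a measure) \<Rightarrow> 'a measure \<Rightarrow> bool" where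
  "invariant_prob I P \<mu> \<longleftrightarrow>
     prob_space \<mu> \<and> sets \<mu> = sets borel \<and> (\<forall>t\<in>I. \<mu> \<bind> P t = \<mu>)"

definition natural_filtration ::
    "'w measure \<Rightarrow> real set \<Rightarrow> (real \<Rightarrow> 'w \<Rightarrow> 'a::euclidean_space) \<Rightarrow> real \<Rightarrow> 'w measure" where
  "natural_filtration M I X s =
     sigma (space M) {X r -` A \<inter> space M | r A. r \<in> I \<and> r \<le> s \<and> A \<in> sets borel}"

text \<open>\<open>X x\<close> is the process started at \<open>x\<close>; \<open>I\<close> is the set of times (containing 0 and closed
  under addition) and \<open>P t\<close> the time-\<open>t\<close> transition kernel.  The case \<open>s = 0\<close> of the Markov
  property says that \<open>X x t\<close> has law \<open>P t x\<close>.\<close>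
definition markov_process ::
    "'w measure \<Rightarrow> real set \<Rightarrow> (real \<Rightarrow> 'a::euclidean_space \<Rightarrow> 'a measure)
      \<Rightarrow> ('a \<Rightarrow> real \<Rightarrow> 'w \<Rightarrow> 'a) \<Rightarrow> bool" where
  "markov_process M I P X \<longleftrightarrow>
     prob_space M \<and>
     (\<forall>t\<in>I. markov_kernel (P t)) \<and>
     (\<forall>x. (AE \<omega> in M. X x 0 \<omega> = x) \<and>
          (\<forall>t\<in>I. X x t \<in> borel_measurable M) \<and>
          (\<forall>s\<in>I. \<forall>t\<in>I. \<forall>A\<in>sets borel.
             AE \<omega> in M.
               real_cond_exp M (natural_filtration M I (X x) s)
                 (\<lambda>\<omega>. indicator A (X x (s + t) \<omega>)) \<omega>
               = measure (P t (X x s \<omega>)) A))"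

text \<open>Numerical schemes: the times are \<open>0, h, 2h, \<dots>\<close>, and with one-step kernel \<open>Q\<close> the kernel
  for physical time \<open>t\<close> is that of \<open>t / h\<close> steps.\<close>

definition grid :: "real \<Rightarrow> real set" where
  "grid h = range (\<lambda>k::nat. real k * h)"

definition scheme_kernel ::
    "real \<Rightarrow> ('a::euclidean_space \<Rightarrow> 'a measure) \<Rightarrow> real \<Rightarrow> 'a \<Rightarrow> 'a measure" where
  "scheme_kernel h Q t = kernel_power Q (nat \<lfloor>t / h\<rfloor>)"

section \<open>Stochastic differential equations\<close>

definition stochastic_basis :: "'w measure \<Rightarrow> (real \<Rightarrow> 'w measure) \<Rightarrow> bool" where
  "stochastic_basis M F \<longleftrightarrow>
     prob_space M \<and> filtration (space M) F \<and> (\<forall>t. subalgebra M (F t))"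

definition wiener_process ::
    "'w measure \<Rightarrow> (real \<Rightarrow> 'w measure) \<Rightarrow> (real \<Rightarrow> 'w \<Rightarrow> real ^ 'm) \<Rightarrow> bool" where
  "wiener_process M F W \<longleftrightarrow>
     (\<forall>t\<ge>0. W t \<in> borel_measurable (F t)) \<and>
     (AE \<omega> in M. W 0 \<omega> = 0) \<and>
     (AE \<omega> in M. continuous_on {0..} (\<lambda>t. W t \<omega>)) \<and>
     (\<forall>s t. 0 \<le> s \<and> s < t \<longrightarrow>
        distributed M lborel (\<lambda>\<omega>. W t \<omega> - W s \<omega>)
          (\<lambda>x. ennreal (\<Prod>i\<in>UNIV. normal_density 0 (sqrt (t - s)) (x $ i))) \<and>
        prob_space.indep_set M (sets (F s))
          {(\<lambda>\<omega>. W t \<omega> - W s \<omega>) -` A \<inter> space M | A. A \<in> sets borel})"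

definition progressive ::
    "(real \<Rightarrow> 'w measure) \<Rightarrow> (real \<Rightarrow> 'w \<Rightarrow> 'b::topological_space) \<Rightarrow> bool" where
  "progressive F H \<longleftrightarrow>
     (\<forall>t\<ge>0. (\<lambda>(s, \<omega>). H s \<omega>) \<in> restrict_space borel {0..t} \<Otimes>\<^sub>M F t \<rightarrow>\<^sub>M borel)"

definition converges_in_prob_0 :: "'w measure \<Rightarrow> (nat \<Rightarrow> 'w \<Rightarrow> ennreal) \<Rightarrow> bool" where
  "converges_in_prob_0 M Z \<longleftrightarrow>
     (\<forall>e>0. (\<lambda>k. measure M {\<omega> \<in> space M. Z k \<omega> > ennreal e}) \<longlonglongrightarrow> 0)"

text \<open>Simple integrands \<open>\<Sum>i<k. \<xi> i \<cdot> 1_(\<tau> i, \<tau> (i+1)]\<close> and their stochastic integrals.\<close>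

definition simple_integrand ::
    "(real \<Rightarrow> 'w measure) \<Rightarrow> nat \<Rightarrow> (nat \<Rightarrow> real) \<Rightarrow> (nat \<Rightarrow> 'w \<Rightarrow> real ^ 'm ^ 'n) \<Rightarrow> bool" where
  "simple_integrand F k \<tau> \<xi> \<longleftrightarrow>
     0 \<le> \<tau> 0 \<and> (\<forall>i<k. \<tau> i \<le> \<tau> (Suc i)) \<and>
     (\<forall>i<k. \<xi> i \<in> borel_measurable (F (\<tau> i)) \<and>
            (\<exists>C. \<forall>\<omega>\<in>space (F (\<tau> i)). norm (\<xi> i \<omega>) \<le> C))"

definition simple_process ::
    "nat \<Rightarrow> (nat \<Rightarrow> real) \<Rightarrow> (nat \<Rightarrow> 'w \<Rightarrow> real ^ 'm ^ 'n) \<Rightarrow> real \<Rightarrow> 'w \<Rightarrow> real ^ 'm ^ 'n" where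
  "simple_process k \<tau> \<xi> s \<omega> = (\<Sum>i<k. indicator {\<tau> i <.. \<tau> (Suc i)} s *\<^sub>R \<xi> i \<omega>)"

definition simple_integral ::
    "(real \<Rightarrow> 'w \<Rightarrow> real ^ 'm) \<Rightarrow> nat \<Rightarrow> (nat \<Rightarrow> real) \<Rightarrow> (nat \<Rightarrow> 'w \<Rightarrow> real ^ 'm ^ 'n)
      \<Rightarrow> real \<Rightarrow> 'w \<Rightarrow> real ^ 'n" where
  "simple_integral W k \<tau> \<xi> t \<omega> =
     (\<Sum>i<k. \<xi> i \<omega> *v (W (min t (\<tau> (Suc i))) \<omega> - W (min t (\<tau> i)) \<omega>))"

text \<open>\<open>J\<close> is (a continuous version of) the Ito integral of \<open>H\<close> with respect to \<open>W\<close>: \<open>H\<close> is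
  progressive and almost surely locally square integrable, and \<open>J\<close> is the limit in probability
  of the integrals of simple integrands approximating \<open>H\<close>.  The norm on matrices is the
  Frobenius norm.\<close>
definition ito_integral ::
    "'w measure \<Rightarrow> (real \<Rightarrow> 'w measure) \<Rightarrow> (real \<Rightarrow> 'w \<Rightarrow> real ^ 'm)
      \<Rightarrow> (real \<Rightarrow> 'w \<Rightarrow> real ^ 'm ^ 'n) \<Rightarrow> (real \<Rightarrow> 'w \<Rightarrow> real ^ 'n) \<Rightarrow> bool" where
  "ito_integral M F W H J \<longleftrightarrow>
     progressive F H \<and>
     (\<forall>t\<ge>0. AE \<omega> in M. (\<integral>\<^sup>+s\<in>{0..t}. ennreal ((norm (H s \<omega>))\<^sup>2) \<partial>lborel) < \<infinity>) \<and>
     (\<forall>t\<ge>0. J t \<in> borel_measurable M) \<and>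
     (AE \<omega> in M. continuous_on {0..} (\<lambda>t. J t \<omega>)) \<and>
     (\<exists>N \<tau> \<xi>.
        (\<forall>k. simple_integrand F (N k) (\<tau> k) (\<xi> k)) \<and>
        (\<forall>t\<ge>0.
           converges_in_prob_0 M (\<lambda>k \<omega>. \<integral>\<^sup>+s\<in>{0..t}.
              ennreal ((norm (simple_process (N k) (\<tau> k) (\<xi> k) s \<omega> - H s \<omega>))\<^sup>2) \<partial>lborel) \<and>
           converges_in_prob_0 M (\<lambda>k \<omega>.
              ennreal (norm (simple_integral W (N k) (\<tau> k) (\<xi> k) t \<omega> - J t \<omega>)))))"

text \<open>\<open>X\<close> solves \<open>dX = f(X) dt + \<sigma>(X) dW\<close> with \<open>X 0 = x\<close>.\<close>
definition sde_solution ::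
    "'w measure \<Rightarrow> (real \<Rightarrow> 'w measure) \<Rightarrow> (real \<Rightarrow> 'w \<Rightarrow> real ^ 'm)
      \<Rightarrow> (real ^ 'n \<Rightarrow> real ^ 'n) \<Rightarrow> (real ^ 'n \<Rightarrow> real ^ 'm ^ 'n)
      \<Rightarrow> real ^ 'n \<Rightarrow> (real \<Rightarrow> 'w \<Rightarrow> real ^ 'n) \<Rightarrow> bool" where
  "sde_solution M F W f \<sigma> x X \<longleftrightarrow>
     (\<forall>t\<ge>0. X t \<in> borel_measurable (F t)) \<and>
     (AE \<omega> in M. continuous_on {0..} (\<lambda>t. X t \<omega>)) \<and>
     (\<exists>J. ito_integral M F W (\<lambda>s \<omega>. \<sigma> (X s \<omega>)) J \<and>
          (AE \<omega> in M. \<forall>t\<ge>0. X t \<omega> = x + (LINT s:{0..t}|lborel. f (X s \<omega>)) + J t \<omega>))"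

text \<open>Existence and pathwise uniqueness from every starting point, on the given stochastic basis.\<close>
definition unique_sde_solution ::
    "'w measure \<Rightarrow> (real \<Rightarrow> 'w measure) \<Rightarrow> (real \<Rightarrow> 'w \<Rightarrow> real ^ 'm)
      \<Rightarrow> (real ^ 'n \<Rightarrow> real ^ 'n) \<Rightarrow> (real ^ 'n \<Rightarrow> real ^ 'm ^ 'n)
      \<Rightarrow> (real ^ 'n \<Rightarrow> real \<Rightarrow> 'w \<Rightarrow> real ^ 'n) \<Rightarrow> bool" where
  "unique_sde_solution M F W f \<sigma> X \<longleftrightarrow>
     (\<forall>x. sde_solution M F W f \<sigma> x (X x) \<and>
          (\<forall>Y. sde_solution M F W f \<sigma> x Y \<longrightarrow> (AE \<omega> in M. \<forall>t\<ge>0. Y t \<omega> = X x t \<omega>)))"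

section \<open>The contraction coefficient\<close>

text \<open>The supremum is taken in \<open>[0, \<infinity>]\<close>: it may be infinite, and it is 0 when \<open>\<Omega>\<close> has at most
  one point.\<close>
definition contraction_coeff ::
    "('a::euclidean_space \<Rightarrow> 'a measure) \<Rightarrow> 'a set \<Rightarrow> ennreal" where
  "contraction_coeff K \<Omega> =
     (SUP (x, y) \<in> {(x, y). x \<in> \<Omega> \<and> y \<in> \<Omega> \<and> x \<noteq> y}.
        ennreal (d_w (return borel x \<bind> K) (return borel y \<bind> K) / tdist x y))"

end

(* The idea: pi = pi P^T and pi' = pi' P'^T, so by the triangle inequality through pi P'^T it
   suffices that d_w(mu K, nu K) <= a d_w(mu, nu) + mu(Omega^c) + nu(Omega^c) for K = P'^T, which
   follows by mixing near-optimal couplings of K x and K y along a near-optimal coupling of mu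
   and nu.  Both the gluing of couplings and the mixing are done approximately, over finitely many
   small Borel cells, so that neither disintegration nor measurable selection is needed: two
   couplings whose inner marginals nu_1 and nu_2 nearly agree on the cells A i are glued by the
   density sum_i 1(y in A i) 1(y' in A i) / max(nu_1(A i), nu_2(A i)), whose marginals are
   dominated by the right ones, and the missing mass costs at most 1 per unit. *)
theory Submission
  imports Defs
begin

text \<open>Since \<open>d_w\<close> is an infimum, every estimate may be proved up to an arbitrary
  positive error, and no optimal coupling has to exist; this is what lets approximate gluing yield
  exact inequalities. The mixing step meets two measurability questions. The function (x, y) |->
  d_w(K x, K y) would have to be integrated; it is replaced by a measurable upper bound
  \<open>\<phi>\<close>, namely a times \<open>tdist\<close> on \<Omega> x \<Omega> and 1 elsewhere.
  The near-optimal coupling would have to depend measurably on (x, y); it is made to depend only on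
  a natural number that codes (x, y), and on the set of pairs with a given code the measures K x and
  K y are replaced by their averages. A finite number of cells cannot capture most of the mass of K
  x uniformly in x. The uncaptured mass is therefore kept as a function of (x, y) until it is
  integrated; it then becomes the tail of the single measure \<mu> K or \<nu> K, which is small. The
  term 2 \<epsilon> comes from the pairs with first or second coordinate outside \<Omega>, where
  only d_w <= 1 is available.\<close>

section \<open>The truncated metric, couplings and first bounds on \<open>d_w\<close>\<close>

lemma tdist_nonneg [simp]: "0 \<le> tdist x y"
  by (simp add: tdist_def)

lemma tdist_le_1 [simp]: "tdist x y \<le> 1"
  by (simp add: tdist_def)

lemma tdist_self [simp]: "tdist x x = 0"
  by (simp add: tdist_def)

lemma tdist_triangle: "tdist x z \<le> tdist x y + tdist y z"
  using norm_triangle_ineq[of "x - y" "y - z"] by (simp add: tdist_def min_def)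
    (smt (verit) norm_ge_zero)

lemma measurable_tdist [measurable (raw)]:
  fixes f g :: "'b \<Rightarrow> 'a::euclidean_space"
  assumes "f \<in> borel_measurable M" "g \<in> borel_measurable M"
  shows "(\<lambda>z. tdist (f z) (g z)) \<in> borel_measurable M"
  unfolding tdist_def using assms by measurable

text \<open>Bridge between the Borel sets of the product space, on which couplings live, and the
  product sigma-algebra carried by \<open>\<Otimes>\<^sub>M\<close>; second countability makes them
  equal.\<close>

lemma sets_borel_pair:
  "sets (borel :: ('a::second_countable_topology \<times> 'a) measure) = sets (borel \<Otimes>\<^sub>M borel)"
  unfolding borel_prod by (rule refl)

lemma measurable_fst_borel [measurable]:
  "fst \<in> borel_measurable (borel :: ('a::second_countable_topology \<times> 'a) measure)"
  by (simp flip: borel_prod)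

lemma measurable_snd_borel [measurable]:
  "snd \<in> borel_measurable (borel :: ('a::second_countable_topology \<times> 'a) measure)"
  by (simp flip: borel_prod)

lemma coupling_spaceD:
  assumes "coupling \<mu> \<nu> \<gamma>"
  shows "\<gamma> \<in> space (prob_algebra borel)" "\<mu> \<in> space (prob_algebra borel)" "\<nu> \<in> space (prob_algebra borel)"
proof -
  have s [measurable_cong]: "sets \<gamma> = sets borel" and p: "prob_space \<gamma>"
    and m: "\<mu> = distr \<gamma> borel fst" "\<nu> = distr \<gamma> borel snd"
    using assms by (auto simp: coupling_def)
  interpret prob_space \<gamma> by (fact p)
  show "\<gamma> \<in> space (prob_algebra borel)" "\<mu> \<in> space (prob_algebra borel)" "\<nu> \<in> space (prob_algebra borel)"
    unfolding m by (auto simp: space_prob_algebra s p intro!: prob_space_distr)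
qed

text \<open>\<open>d_w\<close> is defined by the Bochner integral, but the estimates are carried out
  with the nonnegative integral, which needs no integrability side conditions. A bounded cost on a
  probability space makes the two agree.\<close>

lemma integral_tdist_nn:
  assumes "coupling \<mu> \<nu> \<gamma>"
  shows "(\<integral>\<^sup>+z. ennreal (tdist (fst z) (snd z)) \<partial>\<gamma>) = ennreal (\<integral>z. tdist (fst z) (snd z) \<partial>\<gamma>)"
proof -
  have s [measurable_cong]: "sets \<gamma> = sets borel" and p: "prob_space \<gamma>"
    using assms by (auto simp: coupling_def)
  interpret prob_space \<gamma> by (fact p)
  show ?thesis
    by (intro nn_integral_eq_integral integrable_const_bound[where B=1]) auto
qed

lemma bdd_below_cost:
  "bdd_below ((\<lambda>\<gamma>. \<integral>z. tdist (fst z) (snd z) \<partial>\<gamma>) ` Collect (coupling \<mu> \<nu>))"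
  by (rule bdd_belowI[of _ 0]) (auto intro!: integral_nonneg)

lemma d_w_le:
  assumes "coupling \<mu> \<nu> \<gamma>" "(\<integral>\<^sup>+z. ennreal (tdist (fst z) (snd z)) \<partial>\<gamma>) \<le> ennreal c" "0 \<le> c"
  shows "d_w \<mu> \<nu> \<le> c"
proof -
  have "d_w \<mu> \<nu> \<le> (\<integral>z. tdist (fst z) (snd z) \<partial>\<gamma>)"
    unfolding d_w_def using assms(1) by (intro cINF_lower bdd_below_cost) simp
  also have "\<dots> \<le> c"
    using assms(2,3) unfolding integral_tdist_nn[OF assms(1)] by simp
  finally show ?thesis .
qed

text \<open>The independent coupling guarantees that the infimum in \<open>d_w\<close> runs over a
  nonempty set; otherwise neither approximation nor nonnegativity could be derived.\<close>

lemma coupling_pair: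
  assumes "\<mu> \<in> space (prob_algebra borel)" "\<nu> \<in> space (prob_algebra borel)"
  shows "coupling \<mu> \<nu> (\<mu> \<Otimes>\<^sub>M \<nu>)"
proof -
  have s [measurable_cong, simp]: "sets \<mu> = sets borel" "sets \<nu> = sets borel" and p: "prob_space \<mu>" "prob_space \<nu>"
    using assms by (auto simp: space_prob_algebra)
  interpret M: prob_space \<mu> by (fact p)
  interpret N: prob_space \<nu> by (fact p)
  interpret P: pair_prob_space \<mu> \<nu> ..
  have "sets (\<mu> \<Otimes>\<^sub>M \<nu>) = sets borel"
    unfolding sets_borel_pair by (rule sets_pair_measure_cong) auto
  moreover have "distr (\<mu> \<Otimes>\<^sub>M \<nu>) borel fst = \<mu>"
  proof -
    have "distr (\<mu> \<Otimes>\<^sub>M \<nu>) borel fst = distr (\<mu> \<Otimes>\<^sub>M \<nu>) \<mu> fst" by (rule distr_cong) auto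
    then show ?thesis by (simp add: N.distr_pair_fst)
  qed
  moreover have "distr (\<mu> \<Otimes>\<^sub>M \<nu>) borel snd = \<nu>"
  proof (rule measure_eqI)
    fix A assume "A \<in> sets (distr (\<mu> \<Otimes>\<^sub>M \<nu>) borel snd)"
    then have [measurable]: "A \<in> sets borel" by simp
    have "snd -` A \<inter> space (\<mu> \<Otimes>\<^sub>M \<nu>) = UNIV \<times> A"
      using sets.sets_into_space[of A borel] s[THEN sets_eq_imp_space_eq] by (auto simp: space_pair_measure)
    then show "emeasure (distr (\<mu> \<Otimes>\<^sub>M \<nu>) borel snd) A = emeasure \<nu> A"
      using M.emeasure_space_1 s[THEN sets_eq_imp_space_eq]
      by (simp add: emeasure_distr N.emeasure_pair_measure_Times)
  qed simp
  ultimately show ?thesis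
    unfolding coupling_def using P.prob_space_axioms by simp
qed

lemma d_w_approx:
  assumes "\<mu> \<in> space (prob_algebra borel)" "\<nu> \<in> space (prob_algebra borel)" "0 < e"
  obtains \<gamma> where "coupling \<mu> \<nu> \<gamma>"
    "(\<integral>\<^sup>+z. ennreal (tdist (fst z) (snd z)) \<partial>\<gamma>) \<le> ennreal (d_w \<mu> \<nu> + e)"
proof -
  have "Collect (coupling \<mu> \<nu>) \<noteq> {}" using coupling_pair[OF assms(1,2)] by auto
  moreover have "d_w \<mu> \<nu> < d_w \<mu> \<nu> + e" using assms(3) by simp
  ultimately obtain \<gamma> where "coupling \<mu> \<nu> \<gamma>" "(\<integral>z. tdist (fst z) (snd z) \<partial>\<gamma>) < d_w \<mu> \<nu> + e"
    unfolding d_w_def using bdd_below_cost by (subst (asm) cINF_less_iff) auto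
  then show thesis by (intro that[of \<gamma>]) (auto simp: integral_tdist_nn intro!: ennreal_leI)
qed

lemma d_w_nonneg:
  assumes "\<mu> \<in> space (prob_algebra borel)" "\<nu> \<in> space (prob_algebra borel)"
  shows "0 \<le> d_w \<mu> \<nu>"
  unfolding d_w_def using coupling_pair[OF assms] by (intro cINF_greatest) (auto intro!: integral_nonneg)

lemma d_w_le_1:
  assumes "\<mu> \<in> space (prob_algebra borel)" "\<nu> \<in> space (prob_algebra borel)"
  shows "d_w \<mu> \<nu> \<le> 1"
proof (rule d_w_le[OF coupling_pair[OF assms]])
  interpret prob_space "\<mu> \<Otimes>\<^sub>M \<nu>" using coupling_pair[OF assms] by (simp add: coupling_def)
  have "(\<integral>\<^sup>+z. ennreal (tdist (fst z) (snd z)) \<partial>(\<mu> \<Otimes>\<^sub>M \<nu>)) \<le> (\<integral>\<^sup>+z. 1 \<partial>(\<mu> \<Otimes>\<^sub>M \<nu>))"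
    by (intro nn_integral_mono) (simp flip: ennreal_1)
  then show "(\<integral>\<^sup>+z. ennreal (tdist (fst z) (snd z)) \<partial>(\<mu> \<Otimes>\<^sub>M \<nu>)) \<le> ennreal 1"
    by (simp add: emeasure_space_1)
qed simp

text \<open>The zero-cost coupling of a measure with itself. Besides
  \<open>d_w \<mu> \<mu> = 0\<close>, it later lets the gluing construction compare two measures
  directly.\<close>

lemma coupling_diag:
  assumes "\<mu> \<in> space (prob_algebra borel)"
  shows "coupling \<mu> \<mu> (distr \<mu> borel (\<lambda>x. (x, x)))"
    "(\<integral>\<^sup>+z. ennreal (tdist (fst z) (snd z)) \<partial>distr \<mu> borel (\<lambda>x. (x, x))) = 0"
proof -
  have s [measurable_cong]: "sets \<mu> = sets borel" and p: "prob_space \<mu>"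
    using assms by (auto simp: space_prob_algebra)
  interpret prob_space \<mu> by (fact p)
  have [measurable]: "(\<lambda>x. (x, x)) \<in> \<mu> \<rightarrow>\<^sub>M borel" by (simp flip: borel_prod)
  show "coupling \<mu> \<mu> (distr \<mu> borel (\<lambda>x. (x, x)))"
    by (auto simp: coupling_def distr_distr comp_def intro!: prob_space_distr distr_id2 s s[symmetric])
  show "(\<integral>\<^sup>+z. ennreal (tdist (fst z) (snd z)) \<partial>distr \<mu> borel (\<lambda>x. (x, x))) = 0"
    by (subst nn_integral_distr) auto
qed

lemma d_w_self:
  assumes "\<mu> \<in> space (prob_algebra borel)"
  shows "d_w \<mu> \<mu> = 0"
  using d_w_le[OF coupling_diag(1)[OF assms], of 0] d_w_nonneg[OF assms assms] coupling_diag(2)[OF assms]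
  by simp

text \<open>The defect of the marginals is filled in by the normalised product of the two residual
  measures; the sum of two measures is a bind over the counting measure on \<open>bool\<close>.\<close>
lemma d_w_le_subcoupling:
  fixes \<gamma>\<^sub>0 :: "('a::euclidean_space \<times> 'a) measure"
  assumes \<mu>: "\<mu> \<in> space (prob_algebra borel)" and \<nu>: "\<nu> \<in> space (prob_algebra borel)"
    and s0 [measurable_cong, simp]: "sets \<gamma>\<^sub>0 = sets borel"
    and fst_le: "\<And>A. A \<in> sets borel \<Longrightarrow> emeasure (distr \<gamma>\<^sub>0 borel fst) A \<le> emeasure \<mu> A"
    and snd_le: "\<And>A. A \<in> sets borel \<Longrightarrow> emeasure (distr \<gamma>\<^sub>0 borel snd) A \<le> emeasure \<nu> A"
    and cost: "(\<integral>\<^sup>+z. ennreal (tdist (fst z) (snd z)) \<partial>\<gamma>\<^sub>0) \<le> ennreal c" "0 \<le> c"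
    and mass: "ennreal m \<le> emeasure \<gamma>\<^sub>0 UNIV" "0 \<le> m"
  shows "d_w \<mu> \<nu> \<le> c + (1 - m)"
proof -
  have s [measurable_cong, simp]: "sets \<mu> = sets borel" "sets \<nu> = sets borel" and p: "prob_space \<mu>" "prob_space \<nu>"
    using \<mu> \<nu> by (auto simp: space_prob_algebra)
  have sp [simp]: "space \<mu> = UNIV" "space \<nu> = UNIV" "space \<gamma>\<^sub>0 = UNIV"
    using s[THEN sets_eq_imp_space_eq] s0[THEN sets_eq_imp_space_eq] by auto
  interpret M: prob_space \<mu> by (fact p)
  interpret N: prob_space \<nu> by (fact p)
  define \<mu>' \<nu>' where "\<mu>' = distr \<gamma>\<^sub>0 borel fst" and "\<nu>' = distr \<gamma>\<^sub>0 borel snd"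
  define t where "t = emeasure \<gamma>\<^sub>0 UNIV"
  have t: "emeasure \<mu>' UNIV = t" "emeasure \<nu>' UNIV = t"
    by (simp_all add: \<mu>'_def \<nu>'_def t_def emeasure_distr)
  have M1: "emeasure \<mu> UNIV = 1" "emeasure \<nu> UNIV = 1"
    using M.emeasure_space_1 N.emeasure_space_1 by auto
  have t1: "t \<le> 1"
    using fst_le[of UNIV] M1 by (simp add: t flip: \<mu>'_def)
  have fin: "finite_measure \<mu>'" "finite_measure \<nu>'"
    using t t1 by (auto intro!: finite_measureI simp: \<mu>'_def \<nu>'_def top_unique)
  define R S where "R = diff_measure \<mu> \<mu>'" and "S = diff_measure \<nu> \<nu>'"
  have ss [measurable_cong, simp]: "sets R = sets borel" "sets S = sets borel"
    by (auto simp: R_def S_def)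
  have eR: "emeasure R A = emeasure \<mu> A - emeasure \<mu>' A"
    and eS: "emeasure S A = emeasure \<nu> A - emeasure \<nu>' A" if "A \<in> sets borel" for A
    unfolding R_def S_def using that fst_le snd_le fin
    by (auto intro!: emeasure_diff_measure M.finite_measure_axioms N.finite_measure_axioms
        simp: \<mu>'_def \<nu>'_def)
  \<comment> \<open>Both marginals of \<open>\<gamma>\<^sub>0\<close> have the total mass t of
    \<open>\<gamma>\<^sub>0\<close>, so the residuals \<open>R\<close> and \<open>S\<close> share
    the mass r, and one factor 1 / r normalises both marginals of their product.\<close>
  define r where "r = 1 - t"
  have r: "emeasure R UNIV = r" "emeasure S UNIV = r"
    by (simp_all add: eR eS M1 t r_def)
  have "r \<le> 1" by (simp add: r_def diff_le_self_ennreal)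
  have rfin: "r \<noteq> top" using \<open>r \<le> 1\<close> by (metis ennreal_one_neq_top top_unique)
  have spRS [simp]: "space R = UNIV" "space S = UNIV" by (auto simp: R_def S_def)
  interpret R: finite_measure R by (rule finite_measureI) (simp add: r rfin)
  interpret S: finite_measure S by (rule finite_measureI) (simp add: r rfin)
  define \<rho> where "\<rho> = scale_measure (1 / r) (R \<Otimes>\<^sub>M S)"
  have s\<rho> [measurable_cong, simp]: "sets \<rho> = sets borel"
    unfolding \<rho>_def sets_borel_pair sets_scale_measure by (rule sets_pair_measure_cong) auto
  have sp\<rho> [simp]: "space \<rho> = UNIV" using sets_eq_imp_space_eq[OF s\<rho>] by simp
  \<comment> \<open>The case r = 0 is included: then 1 / r is infinite, but x = 0 and infinity times
    0 is 0 in \<open>ennreal\<close>.\<close>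
  have fill: "1 / r * (x * r) = x" if "x \<le> r" for x
    using that rfin mult_divide_eq_ennreal[of r x]
    by (cases "r = 0") (auto simp: mult.commute[of "1 / r"] ennreal_times_divide)
  have f\<rho>: "emeasure \<rho> (A \<times> UNIV) = emeasure R A" "emeasure \<rho> (UNIV \<times> A) = emeasure S A" if "A \<in> sets borel" for A
  proof -
    have "emeasure R A \<le> r" "emeasure S A \<le> r"
      using r emeasure_space[of R A] emeasure_space[of S A] by auto
    then show "emeasure \<rho> (A \<times> UNIV) = emeasure R A" "emeasure \<rho> (UNIV \<times> A) = emeasure S A"
      using that fill[of "emeasure R A"] fill[of "emeasure S A"]
      by (auto simp: \<rho>_def S.emeasure_pair_measure_Times r mult.commute[of r])
  qed
  have \<rho>m: "emeasure \<rho> UNIV = r"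
    using f\<rho>(1)[of UNIV] r by simp
  define K where "K b = (if b then \<gamma>\<^sub>0 else \<rho>)" for b
  define \<gamma> where "\<gamma> = count_space (UNIV :: bool set) \<bind> K"
  have K: "K \<in> count_space UNIV \<rightarrow>\<^sub>M subprob_algebra borel"
    using t1 \<open>r \<le> 1\<close> by (auto simp: K_def space_subprob_algebra t_def \<rho>m split: if_splits intro!: subprob_spaceI)
  have s\<gamma> [measurable_cong, simp]: "sets \<gamma> = sets borel"
    unfolding \<gamma>_def by (rule sets_bind) (auto simp: K_def)
  have sp\<gamma> [simp]: "space \<gamma> = UNIV" using sets_eq_imp_space_eq[OF s\<gamma>] by simp
  have e\<gamma>: "emeasure \<gamma> A = emeasure \<gamma>\<^sub>0 A + emeasure \<rho> A" if "A \<in> sets borel" for A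
    unfolding \<gamma>_def using that
    by (subst emeasure_bind[OF _ K]) (auto simp: nn_integral_count_space_finite UNIV_bool K_def add.commute)
  have n\<gamma>: "(\<integral>\<^sup>+z. f z \<partial>\<gamma>) = (\<integral>\<^sup>+z. f z \<partial>\<gamma>\<^sub>0) + (\<integral>\<^sup>+z. f z \<partial>\<rho>)" if "f \<in> borel_measurable borel" for f
    unfolding \<gamma>_def using that
    by (subst nn_integral_bind[OF _ K]) (auto simp: nn_integral_count_space_finite UNIV_bool K_def add.commute)
  have pre: "fst -` A = A \<times> UNIV" "snd -` A = UNIV \<times> A" for A :: "'a set" by auto
  have [measurable]: "A \<times> (UNIV :: 'a set) \<in> sets borel" "(UNIV :: 'a set) \<times> A \<in> sets borel" if "A \<in> sets borel" for A :: "'a set"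
    using that unfolding sets_borel_pair by auto
  have "coupling \<mu> \<nu> \<gamma>"
    unfolding coupling_def
  proof (intro conjI)
    show "prob_space \<gamma>"
      using t1 by (intro prob_spaceI) (simp add: e\<gamma> \<rho>m r_def flip: t_def)
    show "distr \<gamma> borel fst = \<mu>"
    proof (rule measure_eqI)
      fix A assume "A \<in> sets (distr \<gamma> borel fst)"
      then have A: "A \<in> sets borel" by simp
      have "emeasure \<mu>' A + (emeasure \<mu> A - emeasure \<mu>' A) = emeasure \<mu> A"
        using fst_le[OF A] by (simp flip: \<mu>'_def)
      then show "emeasure (distr \<gamma> borel fst) A = emeasure \<mu> A"
        using A by (simp add: emeasure_distr e\<gamma> pre f\<rho> eR) (simp add: \<mu>'_def emeasure_distr pre)
    qed simp
    show "distr \<gamma> borel snd = \<nu>"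
    proof (rule measure_eqI)
      fix A assume "A \<in> sets (distr \<gamma> borel snd)"
      then have A: "A \<in> sets borel" by simp
      have "emeasure \<nu>' A + (emeasure \<nu> A - emeasure \<nu>' A) = emeasure \<nu> A"
        using snd_le[OF A] by (simp flip: \<nu>'_def)
      then show "emeasure (distr \<gamma> borel snd) A = emeasure \<nu> A"
        using A by (simp add: emeasure_distr e\<gamma> pre f\<rho> eS) (simp add: \<nu>'_def emeasure_distr pre)
    qed simp
  qed simp
  moreover have "(\<integral>\<^sup>+z. ennreal (tdist (fst z) (snd z)) \<partial>\<gamma>) \<le> ennreal (c + (1 - m))"
  proof -
    have "(\<integral>\<^sup>+z. ennreal (tdist (fst z) (snd z)) \<partial>\<rho>) \<le> (\<integral>\<^sup>+z. 1 \<partial>\<rho>)"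
      by (intro nn_integral_mono) (simp flip: ennreal_1)
    also have "\<dots> = r" by (simp add: \<rho>m)
    also have "\<dots> \<le> 1 - ennreal m"
      unfolding r_def t_def by (intro ennreal_minus_mono mass order_refl)
    also have "\<dots> = ennreal (1 - m)" using mass by (simp flip: ennreal_1 add: ennreal_minus)
    finally have "(\<integral>\<^sup>+z. ennreal (tdist (fst z) (snd z)) \<partial>\<rho>) \<le> ennreal (1 - m)" .
    moreover have "m \<le> 1"
      using order_trans[OF mass(1) t1[unfolded t_def]] by simp
    ultimately show ?thesis
      using cost by (subst n\<gamma>) (auto simp: ennreal_plus intro!: add_mono)
  qed
  moreover have "m \<le> 1"
    using order_trans[OF mass(1) t1[unfolded t_def]] by simp
  ultimately show ?thesis using cost(2) by (intro d_w_le) auto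
qed

section \<open>Approximate gluing of two couplings\<close>

text \<open>The inner marginals \<open>\<nu>\<^sub>1\<close> and \<open>\<nu>\<^sub>2\<close> may
  differ. The triangle inequality takes them equal; the comparison of two measures by their cell
  masses takes both couplings diagonal, so that the inner marginals are the measures
  compared.\<close>

locale gluing =
  fixes \<gamma>\<^sub>1 \<gamma>\<^sub>2 :: "('a::euclidean_space \<times> 'a) measure" and \<mu> \<nu>\<^sub>1 \<nu>\<^sub>2 \<rho> :: "'a measure"
    and A :: "nat \<Rightarrow> 'a set" and N :: nat and \<delta> :: real
  assumes c1: "coupling \<mu> \<nu>\<^sub>1 \<gamma>\<^sub>1" and c2: "coupling \<nu>\<^sub>2 \<rho> \<gamma>\<^sub>2"
    and A [measurable]: "\<And>i. A i \<in> sets borel" and disj: "disjoint_family A"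
    and diam: "\<And>i x y. x \<in> A i \<Longrightarrow> y \<in> A i \<Longrightarrow> tdist x y \<le> \<delta>" and \<delta>: "0 \<le> \<delta>"
begin

lemma sets_couplings [measurable_cong, simp]: "sets \<gamma>\<^sub>1 = sets borel" "sets \<gamma>\<^sub>2 = sets borel"
  using c1 c2 by (auto simp: coupling_def)

lemma space_couplings [simp]: "space \<gamma>\<^sub>1 = UNIV" "space \<gamma>\<^sub>2 = UNIV"
  using sets_couplings[THEN sets_eq_imp_space_eq] by auto

sublocale G1: prob_space \<gamma>\<^sub>1 using c1 by (simp add: coupling_def)
sublocale G2: prob_space \<gamma>\<^sub>2 using c2 by (simp add: coupling_def)
sublocale pair_prob_space \<gamma>\<^sub>1 \<gamma>\<^sub>2 ..

lemma inner_marginals: "\<nu>\<^sub>1 = distr \<gamma>\<^sub>1 borel snd" "\<nu>\<^sub>2 = distr \<gamma>\<^sub>2 borel fst"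
  and outer_marginals: "\<mu> = distr \<gamma>\<^sub>1 borel fst" "\<rho> = distr \<gamma>\<^sub>2 borel snd"
  using c1 c2 by (auto simp: coupling_def)

sublocale N1: prob_space \<nu>\<^sub>1 unfolding inner_marginals by (rule G1.prob_space_distr) simp
sublocale N2: prob_space \<nu>\<^sub>2 unfolding inner_marginals by (rule G2.prob_space_distr) simp

text \<open>If both measures vanish on the cell, division by zero gives the weight 0, which is the
  right value: the cell is ignored.\<close>

definition weight :: "nat \<Rightarrow> real" where
  "weight i = 1 / max (measure \<nu>\<^sub>1 (A i)) (measure \<nu>\<^sub>2 (A i))"

text \<open>A point p is read as ((x, y), (y', z)); the density couples the two pairs by asking y
  and y' to share a cell.\<close>

definition glue_density :: "('a \<times> 'a) \<times> ('a \<times> 'a) \<Rightarrow> ennreal" where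
  "glue_density p = (\<Sum>i<N. ennreal (weight i) * (indicator (A i) (snd (fst p)) * indicator (A i) (fst (snd p))))"

lemma glue_density_measurable [measurable]: "glue_density \<in> borel_measurable (\<gamma>\<^sub>1 \<Otimes>\<^sub>M \<gamma>\<^sub>2)"
  unfolding glue_density_def by measurable

text \<open>Dividing by the maximum keeps both marginals dominated, and max times min is the
  product, so the mass transported through cell i is the smaller of the two cell masses.\<close>

lemma weight_bounds: "0 \<le> weight i" "weight i * measure \<nu>\<^sub>1 (A i) \<le> 1" "weight i * measure \<nu>\<^sub>2 (A i) \<le> 1"
  "weight i * measure \<nu>\<^sub>1 (A i) * measure \<nu>\<^sub>2 (A i) = min (measure \<nu>\<^sub>1 (A i)) (measure \<nu>\<^sub>2 (A i))"
proof -
  have "0 \<le> 1 / max x y" "1 / max x y * x \<le> 1" "1 / max x y * y \<le> 1" "1 / max x y * x * y = min x y"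
    if "0 \<le> x" "0 \<le> y" for x y :: real
    using that by (auto simp: max_def min_def divide_le_eq_1)
  from this[of "measure \<nu>\<^sub>1 (A i)" "measure \<nu>\<^sub>2 (A i)"] show "0 \<le> weight i" "weight i * measure \<nu>\<^sub>1 (A i) \<le> 1" "weight i * measure \<nu>\<^sub>2 (A i) \<le> 1"
  "weight i * measure \<nu>\<^sub>1 (A i) * measure \<nu>\<^sub>2 (A i) = min (measure \<nu>\<^sub>1 (A i)) (measure \<nu>\<^sub>2 (A i))"
    unfolding weight_def by auto
qed

lemma indicator_sum_le_1: "(\<Sum>i<N. indicator (A i) y :: ennreal) \<le> 1"
proof -
  have "(\<Sum>i<N. indicator (A i) y :: ennreal) = indicator (\<Union>i<N. A i) y"
    using disj by (intro indicator_UN_disjoint[symmetric]) (auto simp: disjoint_family_on_def)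
  then show ?thesis by (simp add: indicator_def)
qed

lemma emeasure_nu:
  "(\<integral>\<^sup>+q. indicator (A i) (fst q) \<partial>\<gamma>\<^sub>2) = ennreal (measure \<nu>\<^sub>2 (A i))"
  "(\<integral>\<^sup>+q. indicator (A i) (snd q) \<partial>\<gamma>\<^sub>1) = ennreal (measure \<nu>\<^sub>1 (A i))"
proof -
  have "(\<integral>\<^sup>+q. indicator (A i) (fst q) \<partial>\<gamma>\<^sub>2) = emeasure \<nu>\<^sub>2 (A i)"
    using nn_integral_distr[of fst \<gamma>\<^sub>2 borel "indicator (A i)"] by (simp add: inner_marginals)
  then show "(\<integral>\<^sup>+q. indicator (A i) (fst q) \<partial>\<gamma>\<^sub>2) = ennreal (measure \<nu>\<^sub>2 (A i))"
    by (simp add: N2.emeasure_eq_measure)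
  have "(\<integral>\<^sup>+q. indicator (A i) (snd q) \<partial>\<gamma>\<^sub>1) = emeasure \<nu>\<^sub>1 (A i)"
    using nn_integral_distr[of snd \<gamma>\<^sub>1 borel "indicator (A i)"] by (simp add: inner_marginals)
  then show "(\<integral>\<^sup>+q. indicator (A i) (snd q) \<partial>\<gamma>\<^sub>1) = ennreal (measure \<nu>\<^sub>1 (A i))"
    by (simp add: N1.emeasure_eq_measure)
qed

text \<open>Integrating out the second pair leaves g times the sum of weight i * \<nu>2(A i) over
  the cells containing y. Each term is at most 1, and by disjointness at most one cell contains y. A
  general g serves both the marginals (indicators) and the cost (\<open>tdist\<close>).\<close>

lemma nn_integral_glue_density_fst:
  assumes [measurable]: "g \<in> borel_measurable borel"
  shows "(\<integral>\<^sup>+p. glue_density p * g (fst p) \<partial>(\<gamma>\<^sub>1 \<Otimes>\<^sub>M \<gamma>\<^sub>2)) \<le> (\<integral>\<^sup>+q. g q \<partial>\<gamma>\<^sub>1)"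
proof -
  have "(\<integral>\<^sup>+p. glue_density p * g (fst p) \<partial>(\<gamma>\<^sub>1 \<Otimes>\<^sub>M \<gamma>\<^sub>2)) = (\<integral>\<^sup>+q. \<integral>\<^sup>+q'. glue_density (q, q') * g q \<partial>\<gamma>\<^sub>2 \<partial>\<gamma>\<^sub>1)"
    by (subst G2.nn_integral_fst[symmetric]) auto
  also have "\<dots> = (\<integral>\<^sup>+q. (\<Sum>i<N. ennreal (weight i) * (indicator (A i) (snd q) * ennreal (measure \<nu>\<^sub>2 (A i)))) * g q \<partial>\<gamma>\<^sub>1)"
    unfolding glue_density_def
    by (simp add: nn_integral_multc nn_integral_sum nn_integral_cmult emeasure_nu)
  also have "\<dots> \<le> (\<integral>\<^sup>+q. 1 * g q \<partial>\<gamma>\<^sub>1)"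
  proof (intro nn_integral_mono mult_right_mono)
    fix q :: "'a \<times> 'a"
    have "(\<Sum>i<N. ennreal (weight i) * (indicator (A i) (snd q) * ennreal (measure \<nu>\<^sub>2 (A i))))
      \<le> (\<Sum>i<N. 1 * indicator (A i) (snd q))"
      using weight_bounds(3) by (intro sum_mono) (auto simp: indicator_def simp flip: ennreal_1 ennreal_mult'' intro!: ennreal_leI)
    also have "\<dots> \<le> 1" using indicator_sum_le_1[of "snd q"] by simp
    finally show "(\<Sum>i<N. ennreal (weight i) * (indicator (A i) (snd q) * ennreal (measure \<nu>\<^sub>2 (A i)))) \<le> 1" .
  qed auto
  finally show ?thesis by simp
qed

lemma nn_integral_glue_density_snd:
  assumes [measurable]: "g \<in> borel_measurable borel"
  shows "(\<integral>\<^sup>+p. glue_density p * g (snd p) \<partial>(\<gamma>\<^sub>1 \<Otimes>\<^sub>M \<gamma>\<^sub>2)) \<le> (\<integral>\<^sup>+q. g q \<partial>\<gamma>\<^sub>2)"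
proof -
  have "(\<integral>\<^sup>+p. glue_density p * g (snd p) \<partial>(\<gamma>\<^sub>1 \<Otimes>\<^sub>M \<gamma>\<^sub>2)) = (\<integral>\<^sup>+q'. \<integral>\<^sup>+q. glue_density (q, q') * g q' \<partial>\<gamma>\<^sub>1 \<partial>\<gamma>\<^sub>2)"
    by (subst nn_integral_snd[symmetric]) auto
  also have "\<dots> = (\<integral>\<^sup>+q'. (\<Sum>i<N. ennreal (weight i) * (ennreal (measure \<nu>\<^sub>1 (A i)) * indicator (A i) (fst q'))) * g q' \<partial>\<gamma>\<^sub>2)"
    unfolding glue_density_def
    by (simp add: nn_integral_multc nn_integral_sum nn_integral_cmult emeasure_nu)
  also have "\<dots> \<le> (\<integral>\<^sup>+q'. 1 * g q' \<partial>\<gamma>\<^sub>2)"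
  proof (intro nn_integral_mono mult_right_mono)
    fix q :: "'a \<times> 'a"
    have "(\<Sum>i<N. ennreal (weight i) * (ennreal (measure \<nu>\<^sub>1 (A i)) * indicator (A i) (fst q)))
      \<le> (\<Sum>i<N. 1 * indicator (A i) (fst q))"
      using weight_bounds(2) by (intro sum_mono) (auto simp: indicator_def simp flip: ennreal_1 ennreal_mult'' intro!: ennreal_leI)
    also have "\<dots> \<le> 1" using indicator_sum_le_1[of "fst q"] by simp
    finally show "(\<Sum>i<N. ennreal (weight i) * (ennreal (measure \<nu>\<^sub>1 (A i)) * indicator (A i) (fst q))) \<le> 1" .
  qed auto
  finally show ?thesis by simp
qed

lemma nn_integral_glue_density:
  "(\<integral>\<^sup>+p. glue_density p \<partial>(\<gamma>\<^sub>1 \<Otimes>\<^sub>M \<gamma>\<^sub>2)) = ennreal (\<Sum>i<N. min (measure \<nu>\<^sub>1 (A i)) (measure \<nu>\<^sub>2 (A i)))"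
proof -
  have "(\<integral>\<^sup>+p. glue_density p \<partial>(\<gamma>\<^sub>1 \<Otimes>\<^sub>M \<gamma>\<^sub>2)) = (\<integral>\<^sup>+q. \<integral>\<^sup>+q'. glue_density (q, q') \<partial>\<gamma>\<^sub>2 \<partial>\<gamma>\<^sub>1)"
    by (subst G2.nn_integral_fst[symmetric]) auto
  also have "\<dots> = (\<Sum>i<N. ennreal (weight i) * (ennreal (measure \<nu>\<^sub>1 (A i)) * ennreal (measure \<nu>\<^sub>2 (A i))))"
    unfolding glue_density_def
    by (simp add: nn_integral_sum nn_integral_cmult nn_integral_multc emeasure_nu)
  also have "\<dots> = (\<Sum>i<N. ennreal (min (measure \<nu>\<^sub>1 (A i)) (measure \<nu>\<^sub>2 (A i))))"
    by (simp add: weight_bounds(1) flip: ennreal_mult weight_bounds(4) mult.assoc)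
  also have "\<dots> = ennreal (\<Sum>i<N. min (measure \<nu>\<^sub>1 (A i)) (measure \<nu>\<^sub>2 (A i)))"
    by (intro sum_ennreal) auto
  finally show ?thesis .
qed

text \<open>Travel from x to z through y and y': the outer legs cost at most a and b because the
  glued marginals are dominated, the jump from y to y' stays inside a cell, and the last term is the
  mass that the glued measure lacks.\<close>

lemma d_w_glue:
  assumes cost1: "(\<integral>\<^sup>+z. ennreal (tdist (fst z) (snd z)) \<partial>\<gamma>\<^sub>1) \<le> ennreal a" "0 \<le> a"
    and cost2: "(\<integral>\<^sup>+z. ennreal (tdist (fst z) (snd z)) \<partial>\<gamma>\<^sub>2) \<le> ennreal b" "0 \<le> b"
  shows "d_w \<mu> \<rho> \<le> a + b + \<delta> + (1 - (\<Sum>i<N. min (measure \<nu>\<^sub>1 (A i)) (measure \<nu>\<^sub>2 (A i))))"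
proof -
  define G where "G = density (\<gamma>\<^sub>1 \<Otimes>\<^sub>M \<gamma>\<^sub>2) glue_density"
  have sG [measurable_cong, simp]: "sets G = sets (\<gamma>\<^sub>1 \<Otimes>\<^sub>M \<gamma>\<^sub>2)" by (simp add: G_def)
  have spG [simp]: "space G = UNIV" by (simp add: G_def space_pair_measure)
  define e :: "('a \<times> 'a) \<times> ('a \<times> 'a) \<Rightarrow> 'a \<times> 'a" where "e p = (fst (fst p), snd (snd p))" for p
  have e [measurable]: "e \<in> G \<rightarrow>\<^sub>M borel"
    unfolding e_def by (simp flip: borel_prod)
  have fe: "fst (e p) = fst (fst p)" "snd (e p) = snd (snd p)" for p by (auto simp: e_def)
  have emG: "emeasure (distr (distr G borel e) borel f) B = (\<integral>\<^sup>+p. glue_density p * indicator B (f (e p)) \<partial>(\<gamma>\<^sub>1 \<Otimes>\<^sub>M \<gamma>\<^sub>2))"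
    if [measurable]: "B \<in> sets borel" "f \<in> borel_measurable borel" for B and f :: "'a \<times> 'a \<Rightarrow> 'a"
  proof -
    have "emeasure (distr (distr G borel e) borel f) B = (\<integral>\<^sup>+y. indicator B y \<partial>distr (distr G borel e) borel f)"
      by simp
    also have "\<dots> = (\<integral>\<^sup>+z. indicator B (f z) \<partial>distr G borel e)"
      by (rule nn_integral_distr) auto
    also have "\<dots> = (\<integral>\<^sup>+p. indicator B (f (e p)) \<partial>G)"
      by (rule nn_integral_distr) auto
    also have "\<dots> = (\<integral>\<^sup>+p. glue_density p * indicator B (f (e p)) \<partial>(\<gamma>\<^sub>1 \<Otimes>\<^sub>M \<gamma>\<^sub>2))"
      unfolding G_def by (subst nn_integral_density) auto
    finally show ?thesis .
  qed
  have ends_le: "emeasure (distr (distr G borel e) borel fst) B \<le> emeasure \<mu> B"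
    "emeasure (distr (distr G borel e) borel snd) B \<le> emeasure \<rho> B"
    if [measurable]: "B \<in> sets borel" for B
  proof -
    have "emeasure (distr (distr G borel e) borel fst) B \<le> (\<integral>\<^sup>+q. indicator B (fst q) \<partial>\<gamma>\<^sub>1)"
      by (subst emG) (auto simp: fe intro!: nn_integral_glue_density_fst[of "\<lambda>q. indicator B (fst q)"])
    also have "\<dots> = (\<integral>\<^sup>+y. indicator B y \<partial>\<mu>)" unfolding outer_marginals by (subst nn_integral_distr) auto
    finally show "emeasure (distr (distr G borel e) borel fst) B \<le> emeasure \<mu> B" by (simp add: outer_marginals)
    have "emeasure (distr (distr G borel e) borel snd) B \<le> (\<integral>\<^sup>+q. indicator B (snd q) \<partial>\<gamma>\<^sub>2)"
      by (subst emG) (auto simp: fe intro!: nn_integral_glue_density_snd[of "\<lambda>q. indicator B (snd q)"])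
    also have "\<dots> = (\<integral>\<^sup>+y. indicator B y \<partial>\<rho>)" unfolding outer_marginals by (subst nn_integral_distr) auto
    finally show "emeasure (distr (distr G borel e) borel snd) B \<le> emeasure \<rho> B" by (simp add: outer_marginals)
  qed
  have "(\<integral>\<^sup>+p. glue_density p * 1 \<partial>(\<gamma>\<^sub>1 \<Otimes>\<^sub>M \<gamma>\<^sub>2)) \<le> (\<integral>\<^sup>+q. 1 \<partial>\<gamma>\<^sub>1)"
    using nn_integral_glue_density_fst[of "\<lambda>_. 1"] by simp
  then have density_le_1: "(\<integral>\<^sup>+p. glue_density p \<partial>(\<gamma>\<^sub>1 \<Otimes>\<^sub>M \<gamma>\<^sub>2)) \<le> 1" using G1.emeasure_space_1 by simp
  have density_diam: "glue_density p * ennreal (tdist (snd (fst p)) (fst (snd p))) \<le> glue_density p * ennreal \<delta>" for p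
    unfolding glue_density_def sum_distrib_right using diam
    by (intro sum_mono) (auto simp: indicator_def intro!: mult_left_mono ennreal_leI)
  have "(\<integral>\<^sup>+z. ennreal (tdist (fst z) (snd z)) \<partial>distr G borel e)
      = (\<integral>\<^sup>+p. glue_density p * ennreal (tdist (fst (fst p)) (snd (snd p))) \<partial>(\<gamma>\<^sub>1 \<Otimes>\<^sub>M \<gamma>\<^sub>2))"
    unfolding G_def by (simp add: nn_integral_distr fe e[unfolded G_def] nn_integral_density)
  also have "\<dots> \<le> (\<integral>\<^sup>+p. glue_density p * ennreal (tdist (fst (fst p)) (snd (fst p)))
      + glue_density p * ennreal (tdist (fst (snd p)) (snd (snd p))) + glue_density p * ennreal \<delta> \<partial>(\<gamma>\<^sub>1 \<Otimes>\<^sub>M \<gamma>\<^sub>2))"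
  proof (rule nn_integral_mono)
    fix p :: "('a \<times> 'a) \<times> ('a \<times> 'a)"
    have "tdist (fst (fst p)) (snd (snd p)) \<le> tdist (fst (fst p)) (snd (fst p))
        + tdist (fst (snd p)) (snd (snd p)) + tdist (snd (fst p)) (fst (snd p))"
      using tdist_triangle[of "fst (fst p)" "snd (snd p)" "snd (fst p)"]
        tdist_triangle[of "snd (fst p)" "snd (snd p)" "fst (snd p)"] by linarith
    then have "glue_density p * ennreal (tdist (fst (fst p)) (snd (snd p)))
      \<le> glue_density p * ennreal (tdist (fst (fst p)) (snd (fst p))
        + tdist (fst (snd p)) (snd (snd p)) + tdist (snd (fst p)) (fst (snd p)))"
      by (intro mult_left_mono ennreal_leI) auto
    also have "\<dots> = glue_density p * ennreal (tdist (fst (fst p)) (snd (fst p)))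
      + glue_density p * ennreal (tdist (fst (snd p)) (snd (snd p))) + glue_density p * ennreal (tdist (snd (fst p)) (fst (snd p)))"
      by (simp add: ennreal_plus distrib_left)
    also have "\<dots> \<le> glue_density p * ennreal (tdist (fst (fst p)) (snd (fst p)))
      + glue_density p * ennreal (tdist (fst (snd p)) (snd (snd p))) + glue_density p * ennreal \<delta>"
      by (intro add_left_mono density_diam)
    finally show "glue_density p * ennreal (tdist (fst (fst p)) (snd (snd p)))
      \<le> glue_density p * ennreal (tdist (fst (fst p)) (snd (fst p)))
      + glue_density p * ennreal (tdist (fst (snd p)) (snd (snd p))) + glue_density p * ennreal \<delta>" .
  qed
  also have "\<dots> = (\<integral>\<^sup>+p. glue_density p * ennreal (tdist (fst (fst p)) (snd (fst p))) \<partial>(\<gamma>\<^sub>1 \<Otimes>\<^sub>M \<gamma>\<^sub>2))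
      + (\<integral>\<^sup>+p. glue_density p * ennreal (tdist (fst (snd p)) (snd (snd p))) \<partial>(\<gamma>\<^sub>1 \<Otimes>\<^sub>M \<gamma>\<^sub>2))
      + (\<integral>\<^sup>+p. glue_density p \<partial>(\<gamma>\<^sub>1 \<Otimes>\<^sub>M \<gamma>\<^sub>2)) * ennreal \<delta>"
    by (simp add: nn_integral_add nn_integral_multc)
  also have "\<dots> \<le> ennreal a + ennreal b + 1 * ennreal \<delta>"
    by (intro add_mono mult_right_mono density_le_1 order_trans[OF nn_integral_glue_density_fst[of "\<lambda>z. ennreal (tdist (fst z) (snd z))"] cost1(1)]
        order_trans[OF nn_integral_glue_density_snd[of "\<lambda>z. ennreal (tdist (fst z) (snd z))"] cost2(1)]) auto
  also have "\<dots> = ennreal (a + b + \<delta>)" using cost1 cost2 \<delta> by (simp add: ennreal_plus)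
  finally have cost: "(\<integral>\<^sup>+z. ennreal (tdist (fst z) (snd z)) \<partial>distr G borel e) \<le> ennreal (a + b + \<delta>)" .
  have "emeasure (distr G borel e) UNIV = (\<integral>\<^sup>+p. glue_density p \<partial>(\<gamma>\<^sub>1 \<Otimes>\<^sub>M \<gamma>\<^sub>2))"
    unfolding emeasure_distr[OF e, of UNIV, simplified]
    using emeasure_density[OF glue_density_measurable, of UNIV] sets.top[of "\<gamma>\<^sub>1 \<Otimes>\<^sub>M \<gamma>\<^sub>2"]
    by (simp add: G_def space_pair_measure)
  then have "ennreal (\<Sum>i<N. min (measure \<nu>\<^sub>1 (A i)) (measure \<nu>\<^sub>2 (A i))) \<le> emeasure (distr G borel e) UNIV"
    by (simp add: nn_integral_glue_density)
  with cost show ?thesis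
    using cost1 cost2 \<delta>
    by (intro d_w_le_subcoupling[of _ _ "distr G borel e"] coupling_spaceD[OF c1] coupling_spaceD[OF c2] ends_le)
       (auto intro!: sum_nonneg)
qed

end

section \<open>Partitions into small cells and the triangle inequality for
  \<open>d_w\<close>\<close>

text \<open>By separability, balls of radius \<delta> / 2 around a countable dense set cover the
  space; subtracting from each ball its predecessors makes them disjoint.\<close>

lemma small_borel_partition:
  assumes "0 < \<delta>"
  obtains A :: "nat \<Rightarrow> 'a::euclidean_space set" where
    "\<And>i. A i \<in> sets borel" "disjoint_family A" "(\<Union>i. A i) = UNIV"
    "\<And>i x y. x \<in> A i \<Longrightarrow> y \<in> A i \<Longrightarrow> tdist x y \<le> \<delta>"
proof -
  obtain D :: "'a set" where D: "countable D" "\<And>X. open X \<Longrightarrow> X \<noteq> {} \<Longrightarrow> \<exists>d\<in>D. d \<in> X"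
    using countable_dense_setE by blast
  have "D \<noteq> {}" using D(2)[of UNIV] by auto
  define B where "B i = ball (from_nat_into D i) (\<delta> / 2)" for i
  show thesis
  proof (rule that[of "disjointed B"])
    show "disjointed B i \<in> sets borel" for i
      unfolding disjointed_def B_def by auto
    show "disjoint_family (disjointed B)" by (rule disjoint_family_disjointed)
    have "\<exists>i. x \<in> B i" for x
    proof -
      obtain d where "d \<in> D" "d \<in> ball x (\<delta> / 2)" using D(2)[of "ball x (\<delta> / 2)"] assms by auto
      then show ?thesis
        using from_nat_into_surj[OF D(1), of d] by (auto simp: B_def dist_commute)
    qed
    then show "(\<Union>i. disjointed B i) = UNIV" by (auto simp: UN_disjointed_eq)
    fix i x y assume "x \<in> disjointed B i" "y \<in> disjointed B i"
    then have "x \<in> B i" "y \<in> B i" using disjointed_subset[of B i] by auto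
    then have "dist x y < \<delta>" unfolding B_def by (metis dist_triangle_half_r mem_ball)
    then show "tdist x y \<le> \<delta>" by (simp add: tdist_def dist_norm)
  qed
qed

text \<open>The bound is stated for all large n so that two measures can share one number of
  cells.\<close>

lemma partition_tail:
  fixes A :: "nat \<Rightarrow> 'a::euclidean_space set"
  assumes "\<mu> \<in> space (prob_algebra borel)"
    and A: "\<And>i. A i \<in> sets borel" "disjoint_family A" "(\<Union>i. A i) = UNIV" and "0 < e"
  shows "\<exists>N. \<forall>n\<ge>N. 1 - (\<Sum>i<n. measure \<mu> (A i)) < e"
proof -
  have s: "sets \<mu> = sets borel" and "prob_space \<mu>"
    using assms by (auto simp: space_prob_algebra)
  then interpret prob_space \<mu> by simp
  have "(\<lambda>i. measure \<mu> (A i)) sums measure \<mu> (\<Union>i. A i)"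
    using A by (intro finite_measure_UNION) (auto simp: s)
  moreover have "measure \<mu> (\<Union>i. A i) = 1"
    using prob_space sets_eq_imp_space_eq[OF s] A(3) by simp
  ultimately have "(\<lambda>n. \<Sum>i<n. measure \<mu> (A i)) \<longlonglongrightarrow> 1" by (simp add: sums_def)
  then have "eventually (\<lambda>n. 1 - e < (\<Sum>i<n. measure \<mu> (A i))) sequentially"
    using \<open>0 < e\<close> by (intro order_tendstoD) auto
  then show ?thesis by (auto simp: eventually_sequentially algebra_simps)
qed

lemma d_w_triangle:
  assumes \<mu>: "\<mu> \<in> space (prob_algebra borel)" and \<nu>: "\<nu> \<in> space (prob_algebra borel)"
    and \<rho>: "\<rho> \<in> space (prob_algebra borel)"
  shows "d_w \<mu> \<rho> \<le> d_w \<mu> \<nu> + d_w \<nu> (\<rho> :: 'a::euclidean_space measure)"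
proof (rule field_le_epsilon)
  fix e :: real assume "0 < e"
  \<comment> \<open>Four errors share e: two for near-optimality, one for the cell diameter, one for
    the mass outside the first N cells. With equal inner marginals this tail is the only mass
    lost.\<close>
  then have e: "0 < e / 4" by simp
  obtain A :: "nat \<Rightarrow> 'a set" where A: "\<And>i. A i \<in> sets borel" "disjoint_family A" "(\<Union>i. A i) = UNIV"
    "\<And>i x y. x \<in> A i \<Longrightarrow> y \<in> A i \<Longrightarrow> tdist x y \<le> e / 4"
    using small_borel_partition[OF e] by blast
  obtain N where N: "1 - (\<Sum>i<N. measure \<nu> (A i)) < e / 4"
    using partition_tail[OF \<nu> A(1-3) e] by auto
  obtain \<gamma>\<^sub>1 where 1: "coupling \<mu> \<nu> \<gamma>\<^sub>1"
    "(\<integral>\<^sup>+z. ennreal (tdist (fst z) (snd z)) \<partial>\<gamma>\<^sub>1) \<le> ennreal (d_w \<mu> \<nu> + e / 4)"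
    using d_w_approx[OF \<mu> \<nu> e] by blast
  obtain \<gamma>\<^sub>2 where 2: "coupling \<nu> \<rho> \<gamma>\<^sub>2"
    "(\<integral>\<^sup>+z. ennreal (tdist (fst z) (snd z)) \<partial>\<gamma>\<^sub>2) \<le> ennreal (d_w \<nu> \<rho> + e / 4)"
    using d_w_approx[OF \<nu> \<rho> e] by blast
  interpret gluing \<gamma>\<^sub>1 \<gamma>\<^sub>2 \<mu> \<nu> \<nu> \<rho> A N "e / 4"
    using 1(1) 2(1) A e by unfold_locales auto
  show "d_w \<mu> \<rho> \<le> d_w \<mu> \<nu> + d_w \<nu> \<rho> + e"
    using d_w_glue[OF 1(2) _ 2(2)] d_w_nonneg[OF \<mu> \<nu>] d_w_nonneg[OF \<nu> \<rho>] e N by simp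
qed

text \<open>Gluing the two diagonal couplings costs nothing on the outer legs. This turns closeness
  of finitely many cell masses into closeness in \<open>d_w\<close>, and will compare a value of a
  kernel with its average.\<close>

lemma d_w_le_cells:
  fixes \<mu> \<nu> :: "'a::euclidean_space measure" and A :: "nat \<Rightarrow> 'a set"
  assumes \<mu>: "\<mu> \<in> space (prob_algebra borel)" and \<nu>: "\<nu> \<in> space (prob_algebra borel)"
    and A: "\<And>i. A i \<in> sets borel" "disjoint_family A"
    "\<And>i x y. x \<in> A i \<Longrightarrow> y \<in> A i \<Longrightarrow> tdist x y \<le> \<delta>" and "0 \<le> \<delta>"
  shows "d_w \<mu> \<nu> \<le> \<delta> + (1 - (\<Sum>i<N. min (measure \<mu> (A i)) (measure \<nu> (A i))))"
proof -
  interpret gluing "distr \<mu> borel (\<lambda>x. (x, x))" "distr \<nu> borel (\<lambda>x. (x, x))" \<mu> \<mu> \<nu> \<nu> A N \<delta>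
    using coupling_diag(1)[OF \<mu>] coupling_diag(1)[OF \<nu>] A \<open>0 \<le> \<delta>\<close> by unfold_locales auto
  show ?thesis
    using d_w_glue[of 0 0] by (simp add: coupling_diag(2)[OF \<mu>] coupling_diag(2)[OF \<nu>])
qed

section \<open>Averaging kernels over countably many pieces and mixing couplings\<close>

text \<open>Rounding each function down to a multiple of t gives an integer; finitely many integers
  can be encoded in one natural number.\<close>

lemma countable_code:
  fixes F :: "('b \<Rightarrow> real) set"
  assumes "finite F" "F \<subseteq> borel_measurable M" "0 < t"
  shows "\<exists>c :: 'b \<Rightarrow> nat. c \<in> M \<rightarrow>\<^sub>M count_space UNIV \<and> (\<forall>f\<in>F. \<forall>x y. c x = c y \<longrightarrow> \<bar>f x - f y\<bar> \<le> t)"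
  using assms(1,2)
proof (induction F)
  case empty
  then show ?case by (intro exI[of _ "\<lambda>_. 0"]) auto
next
  case (insert f F)
  then obtain c :: "'b \<Rightarrow> nat" where c: "c \<in> M \<rightarrow>\<^sub>M count_space UNIV"
    "\<forall>f\<in>F. \<forall>x y. c x = c y \<longrightarrow> \<bar>f x - f y\<bar> \<le> t" by auto
  have [measurable]: "f \<in> borel_measurable M" using insert.prems by auto
  note c(1) [measurable]
  define c' where "c' x = to_nat (c x, \<lfloor>f x / t\<rfloor>)" for x
  have "c' \<in> M \<rightarrow>\<^sub>M count_space UNIV"
    unfolding c'_def by measurable
  moreover have "\<bar>g x - g y\<bar> \<le> t" if "g \<in> insert f F" "c' x = c' y" for g x y
  proof (cases "g = f")
    case True
    have eq: "\<lfloor>f x / t\<rfloor> = \<lfloor>f y / t\<rfloor>" using that(2) by (simp add: c'_def)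
    have "\<bar>f x / t - f y / t\<bar> \<le> 1"
      using floor_correct[of "f x / t"] floor_correct[of "f y / t"] eq by linarith
    then have "\<bar>f x / t - f y / t\<bar> * t \<le> t" using \<open>0 < t\<close> by (simp add: mult_left_le_one_le)
    then show ?thesis using True \<open>0 < t\<close> by (simp add: abs_if field_simps split: if_splits)
  next
    case False
    then show ?thesis using that c(2) by (auto simp: c'_def)
  qed
  ultimately show ?case by blast
qed

lemma nn_integral_fibers:
  fixes c :: "'b \<Rightarrow> nat"
  assumes [measurable]: "c \<in> M \<rightarrow>\<^sub>M count_space UNIV" "g \<in> borel_measurable M"
  shows "(\<integral>\<^sup>+z. g z \<partial>M) = (\<Sum>m. \<integral>\<^sup>+z. g z * indicator (c -` {m} \<inter> space M) z \<partial>M)"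
proof -
  have "(\<integral>\<^sup>+z. g z \<partial>M) = (\<integral>\<^sup>+z. (\<Sum>m. g z * indicator (c -` {m} \<inter> space M) z) \<partial>M)"
  proof (rule nn_integral_cong)
    fix z assume z: "z \<in> space M"
    have "(\<lambda>m. g z * indicator (c -` {m} \<inter> space M) z) = (\<lambda>m. if m = c z then g z else 0)"
      using z by (auto simp: indicator_def)
    then show "g z = (\<Sum>m. g z * indicator (c -` {m} \<inter> space M) z)"
      using sums_single[of "c z" "\<lambda>_. g z"] by (simp add: sums_iff)
  qed
  also have "\<dots> = (\<Sum>m. \<integral>\<^sup>+z. g z * indicator (c -` {m} \<inter> space M) z \<partial>M)"
    by (intro nn_integral_suminf borel_measurable_times_ennreal assms
        borel_measurable_indicator measurable_sets[OF assms(1)]) simp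
  finally show ?thesis .
qed

text \<open>On a fibre of c the left-hand kernel is constant with image the conditional average of
  K, so summing over fibres recovers \<open>M \<bind> K\<close> exactly. Null fibres contribute 0 to
  both sides, so \<open>EK\<close> asks nothing of them. Taken with the two projections, this gives
  the mixed coupling its marginals without error.\<close>

lemma distr_bind_fibers:
  fixes c :: "'b \<Rightarrow> nat"
  assumes M: "prob_space M" and c [measurable]: "c \<in> M \<rightarrow>\<^sub>M count_space UNIV"
    and K [measurable]: "K \<in> M \<rightarrow>\<^sub>M prob_algebra N" and f [measurable]: "f \<in> R \<rightarrow>\<^sub>M N"
    and E: "\<And>m. E m \<in> space (prob_algebra R)"
    and EK: "\<And>m. emeasure M (c -` {m} \<inter> space M) \<noteq> 0 \<Longrightarrow>
      distr (E m) N f = uniform_measure M (c -` {m} \<inter> space M) \<bind> K"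
  shows "distr (M \<bind> (\<lambda>z. E (c z))) N f = M \<bind> K"
proof -
  interpret prob_space M by (fact M)
  have ne: "space M \<noteq> {}" by (rule not_empty)
  have "E \<in> count_space UNIV \<rightarrow>\<^sub>M prob_algebra R" using E by simp
  then have Ec: "(\<lambda>z. E (c z)) \<in> M \<rightarrow>\<^sub>M prob_algebra R" using c by (rule measurable_compose_rev)
  note Ec' [measurable] = measurable_prob_algebraD[OF Ec] and K' [measurable] = measurable_prob_algebraD[OF K]
  have D [measurable]: "c -` {m} \<inter> space M \<in> sets M" for m by measurable
  have "distr (M \<bind> (\<lambda>z. E (c z))) N f = M \<bind> (\<lambda>z. distr (E (c z)) N f)"
    using Ec' ne f by (rule distr_bind)
  also have "\<dots> = M \<bind> K"
  proof (rule measure_eqI)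
    have d: "(\<lambda>z. distr (E (c z)) N f) \<in> M \<rightarrow>\<^sub>M subprob_algebra N"
      by (rule measurable_compose[OF Ec' measurable_distr[OF f]])
    show "sets (M \<bind> (\<lambda>z. distr (E (c z)) N f)) = sets (M \<bind> K)"
      using sets_bind[OF sets_kernel[OF d] ne] sets_bind[OF sets_kernel[OF K'] ne] by simp
    fix B assume "B \<in> sets (M \<bind> (\<lambda>z. distr (E (c z)) N f))"
    then have B [measurable]: "B \<in> sets N"
      using sets_bind[OF sets_kernel[OF d] ne] by simp
    define g where "g m = emeasure (distr (E m) N f) B" for m
    have "(\<integral>\<^sup>+z. g (c z) * indicator (c -` {m} \<inter> space M) z \<partial>M)
        = (\<integral>\<^sup>+z. emeasure (K z) B * indicator (c -` {m} \<inter> space M) z \<partial>M)" (is "?l = ?r") for m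
    proof -
      let ?D = "c -` {m} \<inter> space M"
      have "?l = (\<integral>\<^sup>+z. g m * indicator ?D z \<partial>M)"
        by (intro nn_integral_cong) (auto simp: indicator_def)
      then have l: "?l = g m * emeasure M ?D"
        by (simp add: nn_integral_cmult)
      show ?thesis
      proof (cases "emeasure M ?D = 0")
        case True
        then have "AE z in M. z \<notin> ?D" by (intro AE_not_in null_setsI) auto
        then have "?r = (\<integral>\<^sup>+z. 0 \<partial>M)" by (intro nn_integral_cong_AE) auto
        then show ?thesis using l True by simp
      next
        case False
        have "g m = (\<integral>\<^sup>+z. emeasure (K z) B \<partial>uniform_measure M ?D)"
          unfolding g_def EK[OF False] using ne
          by (intro emeasure_bind[where N=N]) auto
        also have "\<dots> = ?r / emeasure M ?D"
          by (rule nn_integral_uniform_measure) measurable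
        finally show ?thesis
          using l False by (simp add: ennreal_divide_times emeasure_eq_measure flip: ennreal_times_divide)
      qed
    qed
    then have "(\<integral>\<^sup>+z. g (c z) \<partial>M) = (\<integral>\<^sup>+z. emeasure (K z) B \<partial>M)"
      using nn_integral_fibers[OF c, of "\<lambda>z. g (c z)"]
        nn_integral_fibers[OF c, of "\<lambda>z. emeasure (K z) B"] by simp
    then show "emeasure (M \<bind> (\<lambda>z. distr (E (c z)) N f)) B = emeasure (M \<bind> K) B"
      using emeasure_bind[OF ne d B] emeasure_bind[OF ne K' B] by (simp add: g_def)
  qed
  finally show ?thesis .
qed

lemma bind_in_prob_algebra:
  assumes "\<mu> \<in> space (prob_algebra M)" "K \<in> M \<rightarrow>\<^sub>M prob_algebra N"
  shows "\<mu> \<bind> K \<in> space (prob_algebra N)"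
  using prob_space_bind'[OF assms] sets_bind'[OF assms] by (simp add: space_prob_algebra)

text \<open>A measurable choice of near-optimal couplings of \<open>K x\<close> and \<open>L y\<close> is avoided: \<open>\<gamma>\<close> is cut into
  countably many pieces on which the masses of finitely many small cells under \<open>K x\<close> and \<open>L y\<close>
  hardly vary, and on each piece only the conditional averages of \<open>K x\<close> and \<open>L y\<close> are coupled.\<close>
lemma d_w_bind_le:
  fixes K L :: "'a::euclidean_space \<Rightarrow> 'a measure" and \<phi> :: "'a \<times> 'a \<Rightarrow> real"
  assumes c: "coupling \<mu> \<nu> \<gamma>"
    and K [measurable]: "K \<in> borel \<rightarrow>\<^sub>M prob_algebra borel"
    and L [measurable]: "L \<in> borel \<rightarrow>\<^sub>M prob_algebra borel"
    and \<phi> [measurable]: "\<phi> \<in> borel_measurable borel" and \<phi>1: "\<And>z. \<phi> z \<le> 1"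
    and KL: "\<And>z. d_w (K (fst z)) (L (snd z)) \<le> \<phi> z"
  shows "d_w (\<mu> \<bind> K) (\<nu> \<bind> L) \<le> (\<integral>z. \<phi> z \<partial>\<gamma>)"
proof (rule field_le_epsilon)
  fix e :: real assume "0 < e"
  \<comment> \<open>Of the seven parts, four pay for replacing K x and L y by averages, one for
    near-optimal couplings of the averages, and two for the tails.\<close>
  define \<eta> where "\<eta> = e / 7"
  have \<eta>: "0 < \<eta>" using \<open>0 < e\<close> by (simp add: \<eta>_def)
  have s [measurable_cong, simp]: "sets \<gamma> = sets borel" and "prob_space \<gamma>"
    using c by (auto simp: coupling_def)
  then interpret prob_space \<gamma> by simp
  have sp [simp]: "space \<gamma> = UNIV" using sets_eq_imp_space_eq[OF s] by simp
  note [simp] = coupling_spaceD[OF c]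
  have Kx: "K x \<in> space (prob_algebra borel)" and Lx: "L x \<in> space (prob_algebra borel)" for x
    using measurable_space[OF K] measurable_space[OF L] by auto
  have \<phi>0: "0 \<le> \<phi> z" for z
    using d_w_nonneg[OF Kx Lx] KL order_trans by blast
  \<comment> \<open>Both measures become mixtures over \<gamma>, so a single partition of the pairs
    serves both kernels.\<close>
  have \<mu>K: "\<mu> \<bind> K = \<gamma> \<bind> (\<lambda>z. K (fst z))" and \<nu>L: "\<nu> \<bind> L = \<gamma> \<bind> (\<lambda>z. L (snd z))"
    using c bind_distr[of fst \<gamma> borel K borel] bind_distr[of snd \<gamma> borel L borel]
    by (auto simp: coupling_def measurable_prob_algebraD)
  obtain A :: "nat \<Rightarrow> 'a set" where A: "\<And>i. A i \<in> sets borel" "disjoint_family A" "(\<Union>i. A i) = UNIV"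
    "\<And>i x y. x \<in> A i \<Longrightarrow> y \<in> A i \<Longrightarrow> tdist x y \<le> \<eta>"
    using small_borel_partition[OF \<eta>] by blast
  note A(1) [measurable]
  \<comment> \<open>The number of cells is fixed by the mixed measures, not by the individual K x,
    whose tails need not be uniformly small.\<close>
  obtain N1 where N1: "\<forall>n\<ge>N1. 1 - (\<Sum>i<n. measure (\<mu> \<bind> K) (A i)) < \<eta>"
    using partition_tail[OF bind_in_prob_algebra[OF _ K] A(1-3) \<eta>, of \<mu>] by auto
  obtain N2 where N2: "\<forall>n\<ge>N2. 1 - (\<Sum>i<n. measure (\<nu> \<bind> L) (A i)) < \<eta>"
    using partition_tail[OF bind_in_prob_algebra[OF _ L] A(1-3) \<eta>, of \<nu>] by auto
  define N where "N = max N1 N2"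
  \<comment> \<open>A drift of t in each of N cells adds up to at most \<eta>; the + 1 covers N =
    0.\<close>
  define t where "t = \<eta> / (real N + 1)"
  have t: "0 < t" "real N * t \<le> \<eta>" using \<eta> by (auto simp: t_def field_simps)
  define k where "k i z = measure (K (fst z)) (A i)" for i and z :: "'a \<times> 'a"
  define l where "l i z = measure (L (snd z)) (A i)" for i and z :: "'a \<times> 'a"
  have k_eq: "k i = (\<lambda>z. measure (K (fst z)) (A i))" and l_eq: "l i = (\<lambda>z. measure (L (snd z)) (A i))" for i
    by (auto simp: k_def l_def)
  have K' [measurable]: "(\<lambda>z. K (fst z)) \<in> \<gamma> \<rightarrow>\<^sub>M prob_algebra borel"
    and L' [measurable]: "(\<lambda>z. L (snd z)) \<in> \<gamma> \<rightarrow>\<^sub>M prob_algebra borel"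
    by measurable
  note K'' = measurable_prob_algebraD[OF K'] and L'' = measurable_prob_algebraD[OF L']
  have k [measurable]: "k i \<in> borel_measurable \<gamma>" and l [measurable]: "l i \<in> borel_measurable \<gamma>" for i
    unfolding k_def l_def using measurable_compose[OF K'' measurable_measure_subprob_algebra[OF A(1)]]
      measurable_compose[OF L'' measurable_measure_subprob_algebra[OF A(1)]] by auto
  have kl01: "0 \<le> k i z" "k i z \<le> 1" "0 \<le> l i z" "l i z \<le> 1" for i z
    using Kx Lx by (auto simp: k_def l_def space_prob_algebra intro!: prob_space.prob_le_1)
  have ki: "integrable \<gamma> (k i)" and li: "integrable \<gamma> (l i)" for i
    using kl01 by (auto intro!: integrable_const_bound[where B=1])
  have \<phi>i: "integrable \<gamma> \<phi>"
    using \<phi>0 \<phi>1 by (auto intro!: integrable_const_bound[where B=1])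
  have intk: "(\<integral>z. k i z \<partial>\<gamma>) = measure (\<mu> \<bind> K) (A i)" and intl: "(\<integral>z. l i z \<partial>\<gamma>) = measure (\<nu> \<bind> L) (A i)" for i
    unfolding \<mu>K \<nu>L k_def l_def measure_bind[OF K'' A(1)] measure_bind[OF L'' A(1)] by auto
  have "finite (k ` {..<N} \<union> l ` {..<N})" "k ` {..<N} \<union> l ` {..<N} \<subseteq> borel_measurable \<gamma>"
    using k l by auto
  from countable_code[OF this t(1)]
  obtain f where f [measurable]: "f \<in> \<gamma> \<rightarrow>\<^sub>M count_space (UNIV :: nat set)"
    and fkl: "\<forall>g\<in>k ` {..<N} \<union> l ` {..<N}. \<forall>z z'. f z = f z' \<longrightarrow> \<bar>g z - g z'\<bar> \<le> t"
    by (elim exE conjE) (rule that)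
  have fk: "\<bar>k i z - k i z'\<bar> \<le> t" and fl: "\<bar>l i z - l i z'\<bar> \<le> t" if "i < N" "f z = f z'" for i z z'
    using fkl[rule_format, of "k i" z z'] fkl[rule_format, of "l i" z z'] that by auto
  define D where "D m = f -` {m} \<inter> space \<gamma>" for m
  have D: "D m \<in> sets \<gamma>" for m unfolding D_def by measurable
  define U where "U m = uniform_measure \<gamma> (D m)" for m
  define \<mu>' where "\<mu>' m = U m \<bind> (\<lambda>z. K (fst z))" for m
  define \<nu>' where "\<nu>' m = U m \<bind> (\<lambda>z. L (snd z))" for m
  have U: "U m \<in> space (prob_algebra \<gamma>)" if "emeasure \<gamma> (D m) \<noteq> 0" for m
    using that by (auto simp: U_def space_prob_algebra intro!: prob_space_uniform_measure)
  have \<mu>': "\<mu>' m \<in> space (prob_algebra borel)" and \<nu>': "\<nu>' m \<in> space (prob_algebra borel)"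
    if "emeasure \<gamma> (D m) \<noteq> 0" for m
    unfolding \<mu>'_def \<nu>'_def using bind_in_prob_algebra[OF U[OF that] K'] bind_in_prob_algebra[OF U[OF that] L'] by auto
  \<comment> \<open>All points of the piece of z give B a mass of at least g z - t, hence so does
    the average over the piece. Only this lower bound is needed, because the cell estimate involves
    minima.\<close>
  have avg: "g z - t \<le> measure (U (f z) \<bind> J) B"
    if pos: "emeasure \<gamma> (D (f z)) \<noteq> 0" and J: "J \<in> \<gamma> \<rightarrow>\<^sub>M prob_algebra borel" and B: "B \<in> sets borel"
      and g: "g = (\<lambda>z. measure (J z) B)" and fg: "\<And>z'. f z = f z' \<Longrightarrow> \<bar>g z - g z'\<bar> \<le> t"
    for z g J and B :: "'a set"
  proof -
    have sU: "sets (U (f z)) = sets \<gamma>" and "prob_space (U (f z))"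
      using U[OF pos] by (auto simp: space_prob_algebra)
    then interpret U: prob_space "U (f z)" by simp
    have J': "J \<in> U (f z) \<rightarrow>\<^sub>M subprob_algebra borel"
      using measurable_prob_algebraD[OF J] by (simp add: measurable_cong_sets[OF sU refl])
    have gm [measurable]: "g \<in> borel_measurable (U (f z))"
      unfolding g by (rule measurable_compose[OF J' measurable_measure_subprob_algebra[OF B]])
    have "prob_space (J z')" for z'
      using measurable_space[OF J, of z'] by (simp add: space_prob_algebra)
    then have "\<bar>g z'\<bar> \<le> 1" for z' by (simp add: g prob_space.prob_le_1)
    then have "integrable (U (f z)) g" by (intro U.integrable_const_bound[where B=1]) auto
    moreover have "g z - t \<le> g z'" if "z' \<in> D (f z)" for z'
      using fg[of z'] that by (simp add: D_def abs_le_iff)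
    then have "AE z' in U (f z). g z - t \<le> g z'"
      unfolding U_def by (intro AE_uniform_measureI D AE_I2) blast
    ultimately have "g z - t \<le> (\<integral>z'. g z' \<partial>U (f z))" by (rule U.integral_ge_const)
    then show ?thesis by (simp add: U.measure_bind[OF J' B] g)
  qed
  \<comment> \<open>Pass from the average of K to K x, then to L y, then to the average of L. Each
    passage to an average costs \<eta> for the cell diameter, at most \<eta> for the drift, and a
    tail depending on z.\<close>
  have cells: "d_w (\<mu>' (f z)) (\<nu>' (f z)) \<le> \<phi> z + 4 * \<eta> + (1 - (\<Sum>i<N. k i z)) + (1 - (\<Sum>i<N. l i z))"
    if pos: "emeasure \<gamma> (D (f z)) \<noteq> 0" for z
  proof -
    have "d_w (\<mu>' (f z)) (K (fst z)) \<le> \<eta> + (1 - (\<Sum>i<N. min (measure (\<mu>' (f z)) (A i)) (k i z)))"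
      unfolding k_def using \<eta> by (intro d_w_le_cells \<mu>'[OF pos] Kx A) auto
    moreover have "(\<Sum>i<N. k i z - t) \<le> (\<Sum>i<N. min (measure (\<mu>' (f z)) (A i)) (k i z))"
      using avg[OF pos K' A(1) k_eq] fk t by (intro sum_mono) (auto simp: \<mu>'_def)
    ultimately have 1: "d_w (\<mu>' (f z)) (K (fst z)) \<le> 2 * \<eta> + (1 - (\<Sum>i<N. k i z))"
      using t(2) by (simp add: sum_subtractf)
    have "d_w (L (snd z)) (\<nu>' (f z)) \<le> \<eta> + (1 - (\<Sum>i<N. min (l i z) (measure (\<nu>' (f z)) (A i))))"
      unfolding l_def using \<eta> by (intro d_w_le_cells \<nu>'[OF pos] Lx A) auto
    moreover have "(\<Sum>i<N. l i z - t) \<le> (\<Sum>i<N. min (l i z) (measure (\<nu>' (f z)) (A i)))"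
      using avg[OF pos L' A(1) l_eq] fl t by (intro sum_mono) (auto simp: \<nu>'_def)
    ultimately have 2: "d_w (L (snd z)) (\<nu>' (f z)) \<le> 2 * \<eta> + (1 - (\<Sum>i<N. l i z))"
      using t(2) by (simp add: sum_subtractf)
    have "d_w (\<mu>' (f z)) (\<nu>' (f z)) \<le> d_w (\<mu>' (f z)) (K (fst z)) + d_w (K (fst z)) (\<nu>' (f z))"
      by (rule d_w_triangle[OF \<mu>'[OF pos] Kx \<nu>'[OF pos]])
    also have "d_w (K (fst z)) (\<nu>' (f z)) \<le> d_w (K (fst z)) (L (snd z)) + d_w (L (snd z)) (\<nu>' (f z))"
      by (rule d_w_triangle[OF Kx Lx \<nu>'[OF pos]])
    finally show ?thesis using 1 2 KL[of z] by linarith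
  qed
  \<comment> \<open>The choice is made over countably many indices, where every function is
    measurable. On null pieces \<gamma> itself serves as an arbitrary probability measure.\<close>
  have "\<exists>E. E \<in> space (prob_algebra borel) \<and> (emeasure \<gamma> (D m) \<noteq> 0 \<longrightarrow> coupling (\<mu>' m) (\<nu>' m) E \<and>
      (\<integral>\<^sup>+z. ennreal (tdist (fst z) (snd z)) \<partial>E) \<le> ennreal (d_w (\<mu>' m) (\<nu>' m) + \<eta>))" for m
  proof (cases "emeasure \<gamma> (D m) = 0")
    case True
    then show ?thesis using coupling_spaceD(1)[OF c] by blast
  next
    case False
    then show ?thesis using d_w_approx[OF \<mu>' \<nu>' \<eta>, of m] coupling_spaceD(1) by metis
  qed
  then obtain E where E: "\<And>m. E m \<in> space (prob_algebra borel)"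
    and Ec: "\<And>m. emeasure \<gamma> (D m) \<noteq> 0 \<Longrightarrow> coupling (\<mu>' m) (\<nu>' m) (E m)"
    and Ecost: "\<And>m. emeasure \<gamma> (D m) \<noteq> 0 \<Longrightarrow>
      (\<integral>\<^sup>+z. ennreal (tdist (fst z) (snd z)) \<partial>E m) \<le> ennreal (d_w (\<mu>' m) (\<nu>' m) + \<eta>)"
    by metis
  have Ef: "(\<lambda>z. E (f z)) \<in> \<gamma> \<rightarrow>\<^sub>M prob_algebra borel"
    using E by (intro measurable_compose[OF f]) simp
  define H where "H = \<gamma> \<bind> (\<lambda>z. E (f z))"
  have "H \<in> space (prob_algebra borel)"
    unfolding H_def by (rule bind_in_prob_algebra[OF _ Ef]) (simp add: space_prob_algebra prob_space_axioms)
  moreover have "distr H borel fst = \<mu> \<bind> K"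
    unfolding H_def \<mu>K using Ec
    by (intro distr_bind_fibers[OF prob_space_axioms f K' measurable_fst_borel E])
       (auto simp: coupling_def \<mu>'_def U_def D_def)
  moreover have "distr H borel snd = \<nu> \<bind> L"
    unfolding H_def \<nu>L using Ec
    by (intro distr_bind_fibers[OF prob_space_axioms f L' measurable_snd_borel E])
       (auto simp: coupling_def \<nu>'_def U_def D_def)
  ultimately have Hc: "coupling (\<mu> \<bind> K) (\<nu> \<bind> L) H"
    by (simp add: coupling_def space_prob_algebra)
  define b where "b z = \<phi> z + 5 * \<eta> + (1 - (\<Sum>i<N. k i z)) + (1 - (\<Sum>i<N. l i z))" for z
  have sum_le: "(\<Sum>i<N. measure \<kappa> (A i)) \<le> 1" if "\<kappa> \<in> space (prob_algebra borel)" for \<kappa>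
  proof -
    have s\<kappa>: "sets \<kappa> = sets borel" and "prob_space \<kappa>" using that by (auto simp: space_prob_algebra)
    then interpret l: prob_space \<kappa> by simp
    have "(\<Sum>i<N. measure \<kappa> (A i)) = measure \<kappa> (\<Union>i<N. A i)"
      using A(2) by (intro l.finite_measure_finite_Union[symmetric]) (auto simp: s\<kappa> disjoint_family_on_def)
    then show ?thesis by simp
  qed
  have b0: "0 \<le> b z" for z
    using \<phi>0[of z] \<eta> sum_le[OF Kx[of "fst z"]] sum_le[OF Lx[of "snd z"]] by (simp add: b_def k_def l_def)
  have bi: "integrable \<gamma> b" unfolding b_def using ki li \<phi>i by auto
  \<comment> \<open>There are only countably many pieces, so the null ones together form a null
    set.\<close>
  have "AE z in \<gamma>. \<forall>m. emeasure \<gamma> (D m) = 0 \<longrightarrow> z \<notin> D m"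
    unfolding AE_all_countable using D by (auto intro!: AE_not_in null_setsI simp del: s)
  then have AEpos: "AE z in \<gamma>. emeasure \<gamma> (D (f z)) \<noteq> 0"
    by eventually_elim (auto simp: D_def)
  have "(\<integral>\<^sup>+z. ennreal (tdist (fst z) (snd z)) \<partial>H)
      = (\<integral>\<^sup>+z. \<integral>\<^sup>+z'. ennreal (tdist (fst z') (snd z')) \<partial>E (f z) \<partial>\<gamma>)"
    unfolding H_def by (rule nn_integral_bind[OF _ measurable_prob_algebraD[OF Ef]]) measurable
  also have "\<dots> \<le> (\<integral>\<^sup>+z. ennreal (b z) \<partial>\<gamma>)"
  proof (rule nn_integral_mono_AE)
    show "AE z in \<gamma>. (\<integral>\<^sup>+z'. ennreal (tdist (fst z') (snd z')) \<partial>E (f z)) \<le> ennreal (b z)"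
      using AEpos
    proof eventually_elim
      case (elim z)
      have "d_w (\<mu>' (f z)) (\<nu>' (f z)) + \<eta> \<le> b z"
        using cells[OF elim] by (simp add: b_def)
      then show ?case using Ecost[OF elim] order_trans ennreal_leI by blast
    qed
  qed
  also have "\<dots> = ennreal (\<integral>z. b z \<partial>\<gamma>)"
    using bi b0 by (intro nn_integral_eq_integral) auto
  finally have "d_w (\<mu> \<bind> K) (\<nu> \<bind> L) \<le> (\<integral>z. b z \<partial>\<gamma>)"
    using b0 by (intro d_w_le[OF Hc]) auto
  \<comment> \<open>Integration turns the pointwise tails into those of \<mu> K and \<nu> L, which
    the choice of N made smaller than \<eta>.\<close>
  also have "\<dots> = (\<integral>z. \<phi> z \<partial>\<gamma>) + 5 * \<eta> + (1 - (\<Sum>i<N. measure (\<mu> \<bind> K) (A i)))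
      + (1 - (\<Sum>i<N. measure (\<nu> \<bind> L) (A i)))"
    unfolding b_def using ki li \<phi>i prob_space by (simp add: intk intl)
  also have "\<dots> \<le> (\<integral>z. \<phi> z \<partial>\<gamma>) + 5 * \<eta> + \<eta> + \<eta>"
    using N1[rule_format, of N] N2[rule_format, of N] by (simp add: N_def)
  finally show "d_w (\<mu> \<bind> K) (\<nu> \<bind> L) \<le> (\<integral>z. \<phi> z \<partial>\<gamma>) + e"
    by (simp add: \<eta>_def)
qed

section \<open>Contraction on \<Omega> and the distance between the invariant measures\<close>

text \<open>The supremum omits the diagonal, so x = y is treated apart. Elsewhere
  \<open>tdist\<close> is positive and the quotient can be cleared.\<close>

lemma d_w_le_contraction_coeff:
  fixes K :: "'a::euclidean_space \<Rightarrow> 'a measure"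
  assumes K: "K \<in> borel \<rightarrow>\<^sub>M prob_algebra borel"
    and a: "contraction_coeff K \<Omega> = ennreal a" "0 \<le> a" and xy: "x \<in> \<Omega>" "y \<in> \<Omega>"
  shows "d_w (K x) (K y) \<le> a * tdist x y"
proof (cases "x = y")
  case True
  then show ?thesis using measurable_space[OF K, of y] by (simp add: d_w_self)
next
  case False
  then have pos: "0 < tdist x y" by (simp add: tdist_def)
  have ret: "return borel z \<bind> K = K z" for z
    using measurable_prob_algebraD[OF K] by (intro bind_return) auto
  have "ennreal (d_w (K x) (K y) / tdist x y) \<le> ennreal a"
    unfolding a(1)[symmetric] contraction_coeff_def using xy False
    by (intro SUP_upper2[of "(x, y)"]) (auto simp: ret)
  then show ?thesis using pos a(2) by (simp add: ennreal_le_iff divide_le_eq)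
qed

text \<open>Contract the pairs of a near-optimal coupling that lie in \<Omega> x \<Omega> and bound
  the others by 1. The \<gamma>-mass of the others is at most the sum of the two marginal masses of
  the complement of \<Omega>.\<close>

lemma d_w_bind_contraction:
  fixes K :: "'a::euclidean_space \<Rightarrow> 'a measure"
  assumes K: "K \<in> borel \<rightarrow>\<^sub>M prob_algebra borel"
    and a: "contraction_coeff K \<Omega> = ennreal a" "0 \<le> a" "a \<le> 1"
    and \<Omega> [measurable]: "\<Omega> \<in> sets borel"
    and \<mu>: "\<mu> \<in> space (prob_algebra borel)" and \<nu>: "\<nu> \<in> space (prob_algebra borel)"
  shows "d_w (\<mu> \<bind> K) (\<nu> \<bind> K) \<le> a * d_w \<mu> \<nu> + measure \<mu> (- \<Omega>) + measure \<nu> (- \<Omega>)"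
proof (rule field_le_epsilon)
  fix e :: real assume "0 < e"
  obtain \<gamma> where \<gamma>: "coupling \<mu> \<nu> \<gamma>"
    "(\<integral>\<^sup>+z. ennreal (tdist (fst z) (snd z)) \<partial>\<gamma>) \<le> ennreal (d_w \<mu> \<nu> + e)"
    using d_w_approx[OF \<mu> \<nu> \<open>0 < e\<close>] by blast
  have s [measurable_cong, simp]: "sets \<gamma> = sets borel" and "prob_space \<gamma>"
    using \<gamma> by (auto simp: coupling_def)
  then interpret prob_space \<gamma> by simp
  have cost: "(\<integral>z. tdist (fst z) (snd z) \<partial>\<gamma>) \<le> d_w \<mu> \<nu> + e"
    using \<gamma>(2) d_w_nonneg[OF \<mu> \<nu>] \<open>0 < e\<close> unfolding integral_tdist_nn[OF \<gamma>(1)]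
    by (subst (asm) ennreal_le_iff) auto
  define \<phi> where "\<phi> z = (if fst z \<in> \<Omega> \<and> snd z \<in> \<Omega> then a * tdist (fst z) (snd z) else 1)" for z
  have \<phi> [measurable]: "\<phi> \<in> borel_measurable borel"
    unfolding \<phi>_def by measurable
  have "a * tdist x y \<le> 1" for x y :: 'a using a by (intro mult_le_one) auto
  then have \<phi>1: "\<phi> z \<le> 1" for z by (simp add: \<phi>_def)
  have \<phi>0: "0 \<le> \<phi> z" for z using a by (simp add: \<phi>_def)
  have "d_w (K x) (K y) \<le> 1" for x y
    using measurable_space[OF K] by (intro d_w_le_1) auto
  then have "d_w (\<mu> \<bind> K) (\<nu> \<bind> K) \<le> (\<integral>z. \<phi> z \<partial>\<gamma>)"
    using d_w_le_contraction_coeff[OF K a(1,2)]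
    by (intro d_w_bind_le[OF \<gamma>(1) K K \<phi> \<phi>1]) (auto simp: \<phi>_def)
  also have "\<dots> \<le> (\<integral>z. a * tdist (fst z) (snd z) + indicator (- \<Omega>) (fst z) + indicator (- \<Omega>) (snd z) \<partial>\<gamma>)"
  proof (rule integral_mono)
    show "integrable \<gamma> \<phi>"
      using \<phi>0 \<phi>1 by (auto intro!: integrable_const_bound[where B=1])
    show "integrable \<gamma> (\<lambda>z. a * tdist (fst z) (snd z) + indicator (- \<Omega>) (fst z) + indicator (- \<Omega>) (snd z))"
      by (intro Bochner_Integration.integrable_add integrable_mult_right integrable_const_bound[where B=1])
         (auto simp: indicator_def)
  qed (use a in \<open>auto simp: \<phi>_def indicator_def\<close>)
  also have "\<dots> = a * (\<integral>z. tdist (fst z) (snd z) \<partial>\<gamma>) + (\<integral>z. indicator (- \<Omega>) (fst z) \<partial>\<gamma>) + (\<integral>z. indicator (- \<Omega>) (snd z) \<partial>\<gamma>)"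
  proof -
    have "integrable \<gamma> (\<lambda>z. tdist (fst z) (snd z))" "integrable \<gamma> (\<lambda>z. indicator (- \<Omega>) (fst z) :: real)"
      "integrable \<gamma> (\<lambda>z. indicator (- \<Omega>) (snd z) :: real)"
      by (auto intro!: integrable_const_bound[where B=1] simp: indicator_def)
    then show ?thesis by simp
  qed
  also have "(\<integral>z. indicator (- \<Omega>) (fst z) \<partial>\<gamma>) = measure \<mu> (- \<Omega>)"
  proof -
    have "(\<integral>z. indicat_real (- \<Omega>) (fst z) \<partial>\<gamma>) = (\<integral>x. indicator (- \<Omega>) x \<partial>distr \<gamma> borel fst)"
      by (subst integral_distr) auto
    then show ?thesis using \<gamma>(1) by (auto simp: coupling_def)
  qed
  also have "(\<integral>z. indicator (- \<Omega>) (snd z) \<partial>\<gamma>) = measure \<nu> (- \<Omega>)"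
  proof -
    have "(\<integral>z. indicat_real (- \<Omega>) (snd z) \<partial>\<gamma>) = (\<integral>x. indicator (- \<Omega>) x \<partial>distr \<gamma> borel snd)"
      by (subst integral_distr) auto
    then show ?thesis using \<gamma>(1) by (auto simp: coupling_def)
  qed
  \<comment> \<open>The error e is multiplied by a, which does not exceed 1.\<close>
  also have "a * (\<integral>z. tdist (fst z) (snd z) \<partial>\<gamma>) \<le> a * d_w \<mu> \<nu> + e"
  proof -
    have "a * e \<le> 1 * e" using a(3) \<open>0 < e\<close> by (intro mult_right_mono) auto
    then show ?thesis using mult_left_mono[OF cost a(2)] by (simp add: distrib_left)
  qed
  finally show "d_w (\<mu> \<bind> K) (\<nu> \<bind> K) \<le> a * d_w \<mu> \<nu> + measure \<mu> (- \<Omega>) + measure \<nu> (- \<Omega>) + e"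
    by (simp add: algebra_simps)
qed

theorem mainTheorem1:
  fixes f :: "real ^ 'n \<Rightarrow> real ^ 'n"
    and \<sigma> :: "real ^ 'n \<Rightarrow> real ^ 'm ^ 'n"
    and M :: "'w measure" and F :: "real \<Rightarrow> 'w measure"
    and W :: "real \<Rightarrow> 'w \<Rightarrow> real ^ 'm"
    and X :: "real ^ 'n \<Rightarrow> real \<Rightarrow> 'w \<Rightarrow> real ^ 'n"
    and P :: "real \<Rightarrow> real ^ 'n \<Rightarrow> (real ^ 'n) measure"
    and M' :: "'v measure"
    and X' :: "real ^ 'n \<Rightarrow> real \<Rightarrow> 'v \<Rightarrow> real ^ 'n"
    and Q :: "real ^ 'n \<Rightarrow> (real ^ 'n) measure"
    and P' :: "real \<Rightarrow> real ^ 'n \<Rightarrow> (real ^ 'n) measure"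
    and \<pi> \<pi>' :: "(real ^ 'n) measure"
    and h T \<epsilon> :: real
    and \<Omega> :: "(real ^ 'n) set"
    and \<alpha> :: ennreal
  assumes f: "continuous_on UNIV f"
    and basis: "stochastic_basis M F"
    and W: "wiener_process M F W"
    and sde: "unique_sde_solution M F W f \<sigma> X"
    and markov: "markov_process M {0..} P X"
    and pi: "invariant_prob {0..} P \<pi>"
    and pi_unique: "\<And>\<nu>. invariant_prob {0..} P \<nu> \<Longrightarrow> \<nu> = \<pi>"
    and h: "h > 0"
    and Q: "markov_kernel Q"
    and P'_def: "P' = scheme_kernel h Q"
    and scheme: "markov_process M' (grid h) P' X'"
    and pi': "invariant_prob (grid h) P' \<pi>'"
    and T: "T > 0" "T \<in> grid h"
    and Omega: "compact \<Omega>"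
    and eps: "0 < \<epsilon>" "\<epsilon> < 1"
    and small: "measure \<pi> (- \<Omega>) < \<epsilon>" "measure \<pi>' (- \<Omega>) < \<epsilon>"
      "measure (\<pi> \<bind> P' T) (- \<Omega>) < \<epsilon>"
    and alpha_def: "\<alpha> = contraction_coeff (P' T) \<Omega>"
    and alpha: "\<alpha> < 1"
  shows "d_w \<pi> \<pi>' \<le> (d_w (\<pi> \<bind> P T) (\<pi> \<bind> P' T) + 2 * \<epsilon>) / (1 - enn2real \<alpha>)"
proof -
  \<comment> \<open>The coefficient may be infinite in general; \<alpha> < 1 makes it a real number,
    so that its multiple of \<open>d_w\<close> can be moved to the left-hand side.\<close>
  define a where "a = enn2real \<alpha>"
  have a: "\<alpha> = ennreal a" "0 \<le> a" "a < 1"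
  proof -
    have "\<alpha> < top" using alpha by (rule less_trans) simp
    then show eq: "\<alpha> = ennreal a" by (simp add: a_def)
    show nn: "0 \<le> a" by (simp add: a_def)
    have "ennreal a < ennreal 1" using alpha eq by simp
    then show "a < 1" using nn by (subst (asm) ennreal_less_iff) auto
  qed
  have KT: "P T \<in> borel \<rightarrow>\<^sub>M prob_algebra borel" and KT': "P' T \<in> borel \<rightarrow>\<^sub>M prob_algebra borel"
    using markov scheme T by (auto simp: markov_process_def markov_kernel_def)
  have \<pi>: "\<pi> \<in> space (prob_algebra borel)" "\<pi> \<bind> P T = \<pi>"
    and \<pi>': "\<pi>' \<in> space (prob_algebra borel)" "\<pi>' \<bind> P' T = \<pi>'"
    using pi pi' T by (auto simp: invariant_prob_def space_prob_algebra)
  have "\<Omega> \<in> sets borel" using Omega by (simp add: borel_compact)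
  then have "d_w (\<pi> \<bind> P' T) (\<pi>' \<bind> P' T) \<le> a * d_w \<pi> \<pi>' + measure \<pi> (- \<Omega>) + measure \<pi>' (- \<Omega>)"
    using a alpha_def by (intro d_w_bind_contraction KT' \<pi>(1) \<pi>'(1)) auto
  moreover have "d_w \<pi> \<pi>' \<le> d_w \<pi> (\<pi> \<bind> P' T) + d_w (\<pi> \<bind> P' T) \<pi>'"
    by (rule d_w_triangle[OF \<pi>(1) bind_in_prob_algebra[OF \<pi>(1) KT'] \<pi>'(1)])
  \<comment> \<open>Invariance enters here: \<pi> = \<pi> P^T makes the first leg of the triangle
    the one-kernel error, and \<pi>' = \<pi>' P'^T makes the second leg contractible.\<close>
  ultimately have "d_w \<pi> \<pi>' * (1 - a) \<le> d_w (\<pi> \<bind> P T) (\<pi> \<bind> P' T) + 2 * \<epsilon>"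
    using small(1,2) unfolding \<pi>(2) \<pi>'(2) by (simp add: algebra_simps)
  then show ?thesis
    using a(3) by (simp add: le_divide_eq flip: a_def)
qed

end
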